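(* Let $n\ge 2$. There exists a constant $c_n$ depending only on $n$ such that the following holds. Suppose that $\Omega$ is homogeneous of degree zero on $\mathbb{R}^n\setminus\{0\}$, has zero average on $\mathbb{S}^{n-1}$, and belongs to $L^{n,\infty}(\mathbb{S}^{n-1})$. Let $w\in A_1$. Then for every smooth function $f$ on $\mathbb{R}^n$ with compact support and every $x\in\mathbb{R}^n$, $$T^\star_\Omega f(x)\le c_n\,\|\Omega\|_{L^{n,\infty}(\mathbb{S}^{n-1})}\,[w]_{A_1}\,T_w(|\nabla f|)(x).$$
   Context: A weight is a non-negative locally integrable function $w$ on $\mathbb{R}^n$, not identically zero; for a ball $B$ write $w(B)=\int_B w(x)\,dx$. The weight $w$ is in the class $A_1$ if there is a constant $C$ such that for every ball $B$, $\frac{1}{|B|}\int_B w(z)\,dz\le C\,w(x)$ for almost every $x\in B$; the least such $C$ is denoted $[w]_{A_1}$. $B(x,r)$ is the Euclidean ball with center $x$ and radius $r$. The potential type operator $T_w$ is $$T_wf(x)=\int_{\mathbb{R}^n}\frac{|x-y|}{w(B(x,|x-y|))}\,f(y)\,w(y)\,dy$$ (for non-negative $f$ the value may be $+\infty$). The maximal truncated rough singular integral is $$T^\star_\Omega f(x)=\sup_{t>0}\left|\int_{|y|>t}\frac{\Omega(y)}{|y|^n}f(x-y)\,dy\right|.$$ Homogeneous of degree zero means $\Omega(\lambda y)=\Omega(y)$ for all $\lambda>0$, $y\neq0$; zero average means $\int_{\mathbb{S}^{n-1}}\Omega\,d\sigma=0$, where $\sigma$ is surface measure on the unit sphere $\mathbb{S}^{n-1}$.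 For $0<p<\infty$, $\|\Omega\|_{L^{p,\infty}(\mathbb{S}^{n-1})}=\sup_{t>0}t\,\sigma(\{\theta\in\mathbb{S}^{n-1}:|\Omega(\theta)|>t\})^{1/p}$, and $L^{p,\infty}(\mathbb{S}^{n-1})$ is the set of functions for which this is finite. *)

theory Defs
  imports "HOL-Analysis.Analysis"
begin

text \<open>
  Surface measure on the unit sphere, via polar coordinates: the measure of \<open>A\<close> is
  \<open>n\<close> times the Lebesgue measure of the cone \<open>{r \<theta> | 0 < r < 1, \<theta> \<in> A}\<close>. It is completed, so
  that measurability on the sphere means measurability in the sense of Lebesgue.
\<close>
definition sphere_measure :: "'a::euclidean_space measure" where
  "sphere_measure =
     completion
       (distr (scale_measure (of_nat DIM('a)) (restrict_space lborel (ball 0 1 - {0})))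
              (restrict_space borel (sphere 0 1))
              (\<lambda>x. x /\<^sub>R norm x))"

text \<open>Intended for finite measures \<open>M\<close> (such as \<^const>\<open>sphere_measure\<close>) and \<open>0 < p < \<infinity>\<close>.\<close>
definition weak_Lp_norm :: "'b measure \<Rightarrow> real \<Rightarrow> ('b \<Rightarrow> real) \<Rightarrow> ennreal" where
  "weak_Lp_norm M p g =
     (SUP t\<in>{0<..}. ennreal (t * measure M {\<theta> \<in> space M. \<bar>g \<theta>\<bar> > t} powr (1 / p)))"

definition weak_Lp :: "'b measure \<Rightarrow> real \<Rightarrow> ('b \<Rightarrow> real) set" where
  "weak_Lp M p = {g \<in> borel_measurable M. weak_Lp_norm M p g < \<infinity>}"

definition homogeneous_degree_zero :: "('a::real_normed_vector \<Rightarrow> real) \<Rightarrow> bool" where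
  "homogeneous_degree_zero \<Omega> \<longleftrightarrow> (\<forall>l>0. \<forall>y. y \<noteq> 0 \<longrightarrow> \<Omega> (l *\<^sub>R y) = \<Omega> y)"

text \<open>
  As usual for weights, "not identically zero" is understood up to null sets.
\<close>
definition weight :: "('a::euclidean_space \<Rightarrow> real) \<Rightarrow> bool" where
  "weight w \<longleftrightarrow>
     w \<in> borel_measurable lebesgue \<and>
     (\<forall>x. 0 \<le> w x) \<and>
     (\<forall>K. compact K \<longrightarrow> set_integrable lebesgue K w) \<and>
     \<not> (AE x in lebesgue. w x = 0)"

definition weight_mass :: "('a::euclidean_space \<Rightarrow> real) \<Rightarrow> 'a set \<Rightarrow> real" where
  "weight_mass w B = (LINT x:B|lebesgue. w x)"

definition A1_bound :: "('a::euclidean_space \<Rightarrow> real) \<Rightarrow> real \<Rightarrow> bool" where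
  "A1_bound w C \<longleftrightarrow>
     (\<forall>a r. 0 < r \<longrightarrow>
        (AE x in lebesgue. x \<in> ball a r \<longrightarrow>
           weight_mass w (ball a r) / measure lebesgue (ball a r) \<le> C * w x))"

definition A1_weights :: "('a::euclidean_space \<Rightarrow> real) set" where
  "A1_weights = {w. weight w \<and> (\<exists>C. A1_bound w C)}"

text \<open>For \<open>w\<close> in \<open>A\<^sub>1\<close> the infimum is attained, so this is the least admissible constant.\<close>
definition A1_const :: "('a::euclidean_space \<Rightarrow> real) \<Rightarrow> real" where
  "A1_const w = Inf {C. A1_bound w C}"

text \<open>
  The operator \<open>T\<^sub>w\<close> on non-negative functions \<open>f\<close>, with values in \<open>[0, \<infinity>]\<close>. The quotient
  \<open>0 / 0 = 0\<close> at \<open>y = x\<close> is immaterial, and \<open>w(B) > 0\<close> for every ball when \<open>w\<close> is in \<open>A\<^sub>1\<close>.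
\<close>
definition potential_op ::
    "('a::euclidean_space \<Rightarrow> real) \<Rightarrow> ('a \<Rightarrow> real) \<Rightarrow> 'a \<Rightarrow> ennreal" where
  "potential_op w f x =
     (\<integral>\<^sup>+ y. ennreal (norm (x - y) / weight_mass w (ball x (norm (x - y))) * f y * w y) \<partial>lebesgue)"

definition maximal_rough_integral ::
    "('a::euclidean_space \<Rightarrow> real) \<Rightarrow> ('a \<Rightarrow> real) \<Rightarrow> 'a \<Rightarrow> ennreal" where
  "maximal_rough_integral \<Omega> f x =
     (SUP t\<in>{0<..}. ennreal \<bar>LINT y:{y. norm y > t}|lebesgue. \<Omega> y / norm y ^ DIM('a) * f (x - y)\<bar>)"

fun Ck :: "nat \<Rightarrow> ('a::euclidean_space \<Rightarrow> real) \<Rightarrow> bool" where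
  "Ck 0 f \<longleftrightarrow> continuous_on UNIV f"
| "Ck (Suc k) f \<longleftrightarrow>
     (\<forall>x. f differentiable at x) \<and> (\<forall>i\<in>Basis. Ck k (\<lambda>x. frechet_derivative f (at x) i))"

definition smooth :: "('a::euclidean_space \<Rightarrow> real) \<Rightarrow> bool" where
  "smooth f \<longleftrightarrow> (\<forall>k. Ck k f)"

definition compactly_supported :: "('a::euclidean_space \<Rightarrow> real) \<Rightarrow> bool" where
  "compactly_supported f \<longleftrightarrow> compact (closure {x. f x \<noteq> 0})"

definition gradient :: "('a::euclidean_space \<Rightarrow> real) \<Rightarrow> 'a \<Rightarrow> 'a" where
  "gradient f x = (\<Sum>i\<in>Basis. frechet_derivative f (at x) i *\<^sub>R i)"

end

theory Submission
  imports Defs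
begin

text \<open>
  The estimate factors through the Riesz potential of order one of the gradient: with a constant \<open>c\<close> that
  depends on the dimension only, every truncated integral at \<open>x\<close> is at most
  \<open>c N \<integral> |x - y|\<^bsup>1-n\<^esup> |\<nabla> f (y)| dy\<close>, where \<open>N\<close> is the weak norm of \<open>\<Omega>\<close>
  (\<open>truncated_rough_integral_le_riesz_potential\<close>), and the \<open>A\<^sub>1\<close> condition gives
  \<open>|x - y|\<^bsup>-n\<^esup> \<le> c [w] w(y) / w(B(x, |x - y|))\<close> for almost every \<open>y\<close>
  (\<open>riesz_kernel_le_A1_kernel\<close>).

  For the first estimate write \<open>g(y) = f(x - y)\<close> and use polar coordinates \<open>y = r \<theta>\<close>. As
  \<open>\<Omega>\<close> has mean zero on the sphere, the integral does not change if the radial function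
  \<open>y \<mapsto> g(|y| z)\<close> is subtracted from \<open>g\<close>, for any fixed \<open>z \<noteq> 0\<close>. The difference
  \<open>g(r \<theta>) - g(r z)\<close> is an integral of the gradient along a segment, and averaging over \<open>z\<close> in
  the unit ball \<open>B\<close> yields at most a constant times
  \<open>r \<integral>\<^sub>B |\<nabla> g(r u)| |u - \<theta>|\<^bsup>1-n\<^esup> du\<close> (\<open>subrepresentation_bound\<close>).
  The truncated integral is therefore at most a constant times
  \<open>\<integral> |\<Omega>(\<theta>)| \<integral>\<^bsub>r > 0\<^esub> \<integral>\<^sub>B |\<nabla> g(r u)| |u - \<theta>|\<^bsup>1-n\<^esup> du dr d\<sigma>(\<theta>)\<close>.

  Integrating over the radius \<open>r\<close> before \<open>\<theta>\<close> is decisive. Substituting \<open>v = r u\<close>, the double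
  integral over \<open>r\<close> and \<open>u\<close> becomes an integral of \<open>|\<nabla> g(v)| |v|\<^bsup>1-n\<^esup>\<close> against a kernel in the
  angle between \<open>v\<close> and \<open>\<theta>\<close>, of an order slightly above \<open>n - 2\<close> and below the dimension
  \<open>n - 1\<close> of the sphere (\<open>dilated_potential_bound\<close>). The potential of \<open>|\<Omega>|\<close> on the sphere with this
  kernel is bounded uniformly in the direction of \<open>v\<close>, by Young's inequality and dyadic
  decomposition, since \<open>\<Omega>\<close> is in weak \<open>L\<^sup>n\<close> and a spherical cap of radius \<open>d\<close> has measure
  of order \<open>d\<^bsup>n-1\<^esup>\<close> (\<open>cap_potential_bound\<close>). What remains is the Riesz potential of the gradient.
\<close>

section \<open>Polar coordinates\<close>

lemma nn_integral_lborel_affine: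
  fixes f :: "'a::euclidean_space \<Rightarrow> ennreal"
  assumes [measurable]: "f \<in> borel_measurable borel" and c: "c \<noteq> 0"
  shows "(\<integral>\<^sup>+x. f x \<partial>lborel) = ennreal (\<bar>c\<bar> ^ DIM('a)) * (\<integral>\<^sup>+x. f (t + c *\<^sub>R x) \<partial>lborel)"
  by (subst lborel_affine[OF c, of t])
     (simp add: nn_integral_density nn_integral_distr nn_integral_cmult)

lemma nn_integral_inverse_power_tail:
  fixes n :: nat and c :: real
  assumes "n > 0" "c > 0"
  shows "(\<integral>\<^sup>+s. ennreal (1 / s ^ Suc n) * indicator {c..} s \<partial>lborel) = ennreal (1 / (n * c ^ n))"
proof -
  have "(\<integral>\<^sup>+s. ennreal (1 / s ^ Suc n) * indicator {c..} s \<partial>lborel)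
      = ennreal (0 - (- (1 / n) * inverse c ^ n))"
  proof (rule nn_integral_FTC_atLeast)
    fix x :: real assume "c \<le> x"
    with assms have "x > 0" by simp
    obtain m where m: "n = Suc m" using assms by (cases n) auto
    have "DERIV (\<lambda>s. - (1 / n) * inverse s ^ n) x :>
        - (1 / n) * (n * (- (inverse x * 1 * inverse x)) * inverse x ^ (n - 1))"
      using \<open>x > 0\<close> by (auto intro!: derivative_eq_intros)
    also have "- (1 / n) * (n * (- (inverse x * 1 * inverse x)) * inverse x ^ (n - 1)) = 1 / x ^ Suc n"
      using assms \<open>x > 0\<close> by (simp add: m power_inverse divide_inverse)
    finally show "DERIV (\<lambda>s. - (1 / n) * inverse s ^ n) x :> 1 / x ^ Suc n" .
    show "0 \<le> 1 / x ^ Suc n" using \<open>x > 0\<close> by simp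
  next
    have "((\<lambda>s. - (1 / n) * inverse s ^ n) \<longlongrightarrow> - (1 / n) * (0::real) ^ n) at_top"
      by (intro tendsto_intros tendsto_inverse_0_at_top filterlim_ident)
    then show "((\<lambda>s. - (1 / n) * inverse s ^ n) \<longlongrightarrow> (0::real)) at_top"
      using assms by (simp add: zero_power)
  qed simp
  then show ?thesis using assms by (simp add: power_inverse field_simps)
qed

lemma ball_borel_measurable [measurable]: "ball (x::'a::euclidean_space) r \<in> sets borel"
  and singleton_borel_measurable [measurable]: "{x} \<in> sets borel"
  by auto

text \<open>
  The Borel measure on the whole space, carried by the unit sphere, whose restriction to the sphere has the
  completion \<^const>\<open>sphere_measure\<close>. Living on the whole space, it has the Borel sets of the space
  as measurable sets, which makes product measures and Fubini's theorem directly applicable.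
\<close>
definition sph :: "'a::euclidean_space measure" where
  "sph = distr
     (distr (scale_measure (of_nat DIM('a)) (restrict_space lborel (ball 0 1 - {0})))
              (restrict_space borel (sphere 0 1))
              (\<lambda>x. x /\<^sub>R norm x)) borel (\<lambda>x. x)"

lemma sgn_measurable [measurable]: "(sgn :: 'a::euclidean_space \<Rightarrow> 'a) \<in> borel_measurable borel"
proof -
  have "(sgn :: 'a \<Rightarrow> 'a) = (\<lambda>x. x /\<^sub>R norm x)" by (auto simp: sgn_div_norm)
  then show ?thesis by simp
qed

lemma sets_sph [simp, measurable_cong]: "sets sph = sets borel"
  and space_sph [simp]: "space sph = UNIV"
  by (auto simp: sph_def)

lemma radial_projection_measurable:
  "(\<lambda>x. x /\<^sub>R norm x) \<in> restrict_space lborel (ball 0 1 - {0::'a::euclidean_space})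
     \<rightarrow>\<^sub>M restrict_space borel (sphere 0 1)"
  by (rule measurable_restrict_space2)
     (auto intro!: measurable_restrict_space1 simp: space_restrict_space)

lemma nn_integral_sph:
  fixes F :: "'a::euclidean_space \<Rightarrow> ennreal"
  assumes F [measurable]: "F \<in> borel_measurable borel"
  shows "(\<integral>\<^sup>+\<theta>. F \<theta> \<partial>sph)
    = (\<integral>\<^sup>+y. of_nat DIM('a) * F (sgn y) * indicator (ball 0 1 - {0}) y \<partial>lborel)"
proof -
  let ?p = "\<lambda>x::'a. x /\<^sub>R norm x"
  let ?R = "restrict_space lborel (ball 0 1 - {0::'a})"
  let ?S = "restrict_space borel (sphere 0 (1::real)) :: 'a measure"
  have p: "?p \<in> scale_measure (of_nat DIM('a)) ?R \<rightarrow>\<^sub>M ?S"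
    using radial_projection_measurable by (simp cong: measurable_cong_sets)
  have i: "(\<lambda>x. x) \<in> distr (scale_measure (of_nat DIM('a)) ?R) ?S ?p \<rightarrow>\<^sub>M borel"
    by (simp add: measurable_restrict_space1)
  have "(\<integral>\<^sup>+\<theta>. F \<theta> \<partial>sph) = (\<integral>\<^sup>+\<theta>. F \<theta> \<partial>distr (scale_measure (of_nat DIM('a)) ?R) ?S ?p)"
    unfolding sph_def by (rule nn_integral_distr[OF i]) simp
  also have "\<dots> = (\<integral>\<^sup>+y. F (?p y) \<partial>scale_measure (of_nat DIM('a)) ?R)"
    by (rule nn_integral_distr[OF p]) (simp add: measurable_restrict_space1)
  also have "\<dots> = of_nat DIM('a) * (\<integral>\<^sup>+y. F (?p y) \<partial>?R)"
    by (rule nn_integral_scale_measure) (auto intro!: measurable_restrict_space1)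
  also have "\<dots> = of_nat DIM('a) * (\<integral>\<^sup>+y. F (?p y) * indicator (ball 0 1 - {0}) y \<partial>lborel)"
    by (subst nn_integral_restrict_space) auto
  also have "\<dots> = (\<integral>\<^sup>+y. of_nat DIM('a) * F (sgn y) * indicator (ball 0 1 - {0}) y \<partial>lborel)"
    unfolding sgn_div_norm[symmetric] mult.assoc by (rule nn_integral_cmult[symmetric]) measurable
  finally show ?thesis .
qed

lemma AE_sph_norm: "AE \<theta> in (sph :: 'a::euclidean_space measure). norm \<theta> = 1"
proof (rule AE_I[where N="- sphere 0 1"])
  have "emeasure (sph :: 'a measure) (- sphere 0 1) = (\<integral>\<^sup>+\<theta>. indicator (- sphere 0 1) (\<theta>::'a) \<partial>sph)"
    by (subst nn_integral_indicator) auto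
  also have "\<dots> = (\<integral>\<^sup>+y. of_nat DIM('a) * indicator (- sphere 0 1) (sgn y) * indicator (ball 0 1 - {0}) y \<partial>(lborel::'a measure))"
    by (rule nn_integral_sph) simp
  also have "\<dots> = (\<integral>\<^sup>+y. 0 \<partial>(lborel :: 'a measure))"
    by (intro nn_integral_cong) (auto simp: indicator_def norm_sgn)
  finally show "emeasure (sph :: 'a measure) (- sphere 0 1) = 0" by simp
qed auto

lemma emeasure_sph_UNIV:
  "emeasure (sph :: 'a::euclidean_space measure) UNIV
    = ennreal (DIM('a) * measure lborel (ball (0::'a) 1))"
proof -
  have "emeasure (sph :: 'a measure) UNIV = (\<integral>\<^sup>+\<theta>. 1 \<partial>(sph :: 'a measure))"
    by simp
  also have "\<dots> = (\<integral>\<^sup>+y. of_nat DIM('a) * 1 * indicator (ball 0 1 - {0}) y \<partial>(lborel::'a measure))"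
    by (rule nn_integral_sph) simp
  also have "\<dots> = of_nat DIM('a) * emeasure lborel (ball (0::'a) 1 - {0})"
    by (simp add: nn_integral_cmult_indicator)
  also have "emeasure lborel (ball (0::'a) 1 - {0}) = emeasure lborel (ball (0::'a) 1)"
    by (rule emeasure_Diff_null_set) auto
  also have "\<dots> = ennreal (measure lborel (ball (0::'a) 1))"
    using emeasure_lborel_ball_finite[of "0::'a" 1] by (intro emeasure_eq_ennreal_measure) auto
  finally show ?thesis by (simp add: ennreal_mult ennreal_of_nat_eq_real_of_nat)
qed

lemma finite_measure_sph: "finite_measure (sph :: 'a::euclidean_space measure)"
  by (rule finite_measureI) (use emeasure_sph_UNIV[where 'a='a] in auto)

interpretation sph: finite_measure "sph :: 'a::euclidean_space measure"
  by (rule finite_measure_sph)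

lemma pair_sigma_finite_sph:
  "pair_sigma_finite (lborel :: 'b::euclidean_space measure) (sph :: 'a::euclidean_space measure)"
  by (simp add: pair_sigma_finite_def sigma_finite_lborel sph.sigma_finite_measure_axioms)

lemma nn_integral_lborel_swap:
  fixes F :: "'a::euclidean_space \<Rightarrow> 'b::euclidean_space \<Rightarrow> ennreal"
  assumes "(\<lambda>(x, y). F x y) \<in> borel_measurable (borel \<Otimes>\<^sub>M borel)"
  shows "(\<integral>\<^sup>+x. \<integral>\<^sup>+y. F x y \<partial>lborel \<partial>lborel) = (\<integral>\<^sup>+y. \<integral>\<^sup>+x. F x y \<partial>lborel \<partial>lborel)"
proof -
  have "(\<lambda>(x, y). F x y) \<in> borel_measurable (lborel \<Otimes>\<^sub>M lborel)"
    using assms by (simp cong: measurable_cong_sets sets_pair_measure_cong)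
  from lborel_pair.Fubini'[OF this] show ?thesis by simp
qed

lemma nn_integral_sph_swap:
  fixes F :: "'a::euclidean_space \<Rightarrow> 'b::euclidean_space \<Rightarrow> ennreal"
  assumes "(\<lambda>(x, y). F x y) \<in> borel_measurable (borel \<Otimes>\<^sub>M borel)"
  shows "(\<integral>\<^sup>+\<theta>. \<integral>\<^sup>+y. F y \<theta> \<partial>lborel \<partial>sph) = (\<integral>\<^sup>+y. \<integral>\<^sup>+\<theta>. F y \<theta> \<partial>sph \<partial>lborel)"
proof -
  have "(\<lambda>(x, y). F x y) \<in> borel_measurable (lborel \<Otimes>\<^sub>M sph)"
    using assms by (simp cong: measurable_cong_sets sets_pair_measure_cong)
  from pair_sigma_finite.Fubini'[OF pair_sigma_finite_sph this] show ?thesis by simp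
qed

text \<open>
  Scaling and Tonelli suffice. By the definition of \<^const>\<open>sph\<close> the
  right-hand side is an average over \<open>y\<close> in the unit ball of an integral along the ray through \<open>y\<close>.
  With \<open>r = s |y|\<close> and then \<open>z = s y\<close>, it turns into
  \<open>\<integral> n |z|\<^sup>n F(z) (\<integral>\<^bsub>s > |z|\<^esub> s\<^bsup>-n-1\<^esup> ds) dz\<close>, and the inner integral is
  \<open>1 / (n |z|\<^sup>n)\<close>.
\<close>
lemma polar_coordinates:
  fixes F :: "'a::euclidean_space \<Rightarrow> ennreal"
  assumes F [measurable]: "F \<in> borel_measurable borel"
  shows "(\<integral>\<^sup>+y. F y \<partial>lborel)
    = (\<integral>\<^sup>+\<theta>. \<integral>\<^sup>+r. ennreal (r ^ (DIM('a) - 1)) * F (r *\<^sub>R \<theta>) * indicator {0<..} r \<partial>lborel \<partial>sph)"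
proof -
  let ?n = "DIM('a)"
  let ?B = "ball 0 1 - {0::'a}"
  have "(\<integral>\<^sup>+\<theta>. \<integral>\<^sup>+r. ennreal (r ^ (?n - 1)) * F (r *\<^sub>R \<theta>) * indicator {0<..} r \<partial>lborel \<partial>sph)
      = (\<integral>\<^sup>+y. of_nat ?n * (\<integral>\<^sup>+r. ennreal (r ^ (?n - 1)) * F (r *\<^sub>R sgn y) * indicator {0<..} r \<partial>lborel)
           * indicator ?B y \<partial>lborel)"
    by (rule nn_integral_sph) measurable
  also have "\<dots> = (\<integral>\<^sup>+y. \<integral>\<^sup>+s. of_nat ?n * ennreal (norm y ^ ?n) * indicator ?B y
       * (ennreal (s ^ (?n - 1)) * F (s *\<^sub>R y) * indicator {0<..} s) \<partial>lborel \<partial>lborel)"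
  proof (intro nn_integral_cong)
    fix y :: 'a
    show "of_nat ?n * (\<integral>\<^sup>+r. ennreal (r ^ (?n - 1)) * F (r *\<^sub>R sgn y) * indicator {0<..} r \<partial>lborel) * indicator ?B y
      = (\<integral>\<^sup>+s. of_nat ?n * ennreal (norm y ^ ?n) * indicator ?B y
       * (ennreal (s ^ (?n - 1)) * F (s *\<^sub>R y) * indicator {0<..} s) \<partial>lborel)"
    proof (cases "y = 0")
      case False
      have *: "(\<integral>\<^sup>+r. ennreal (r ^ (?n - 1)) * F (r *\<^sub>R sgn y) * indicator {0<..} r \<partial>lborel)
        = ennreal \<bar>norm y\<bar> * (\<integral>\<^sup>+s. ennreal ((0 + norm y * s) ^ (?n - 1)) * F ((0 + norm y * s) *\<^sub>R sgn y) * indicator {0<..} (0 + norm y * s) \<partial>lborel)"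
        by (rule nn_integral_real_affine) (use False in auto)
      also have "\<dots> = (\<integral>\<^sup>+s. ennreal \<bar>norm y\<bar> * (ennreal ((0 + norm y * s) ^ (?n - 1)) * F ((0 + norm y * s) *\<^sub>R sgn y) * indicator {0<..} (0 + norm y * s)) \<partial>lborel)"
        by (subst nn_integral_cmult) auto
      also have "\<dots> = (\<integral>\<^sup>+s. ennreal (norm y ^ ?n) * (ennreal (s ^ (?n - 1)) * F (s *\<^sub>R y) * indicator {0<..} s) \<partial>lborel)"
      proof (intro nn_integral_cong)
        fix s :: real
        have e: "(norm y * s) *\<^sub>R sgn y = s *\<^sub>R y"
          using False by (simp add: sgn_div_norm)
        have i: "indicator {0<..} (norm y * s) = (indicator {0<..} s :: ennreal)"
          using False by (auto simp: indicator_def zero_less_mult_iff)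
        show "ennreal \<bar>norm y\<bar> * (ennreal ((0 + norm y * s) ^ (?n - 1)) * F ((0 + norm y * s) *\<^sub>R sgn y) * indicator {0<..} (0 + norm y * s))
          = ennreal (norm y ^ ?n) * (ennreal (s ^ (?n - 1)) * F (s *\<^sub>R y) * indicator {0<..} s)"
        proof (cases "s > 0")
          case True
          have "norm y * (norm y * s) ^ (?n - 1) = norm y ^ ?n * s ^ (?n - 1)"
            by (cases ?n) (simp_all add: power_mult_distrib)
          then have "ennreal (norm y) * ennreal ((norm y * s) ^ (?n - 1)) = ennreal (norm y ^ ?n) * ennreal (s ^ (?n - 1))"
            using True by (simp flip: ennreal_mult)
          then show ?thesis by (simp add: e i flip: mult.assoc)
        qed (simp add: i e)
      qed
      also have "\<dots> = ennreal (norm y ^ ?n) * (\<integral>\<^sup>+s. (ennreal (s ^ (?n - 1)) * F (s *\<^sub>R y) * indicator {0<..} s) \<partial>lborel)"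
        by (rule nn_integral_cmult) measurable
      finally have "(\<integral>\<^sup>+r. ennreal (r ^ (?n - 1)) * F (r *\<^sub>R sgn y) * indicator {0<..} r \<partial>lborel) = \<dots>" .
      moreover have "(\<integral>\<^sup>+s. of_nat ?n * ennreal (norm y ^ ?n) * indicator ?B y
       * (ennreal (s ^ (?n - 1)) * F (s *\<^sub>R y) * indicator {0<..} s) \<partial>lborel)
        = of_nat ?n * ennreal (norm y ^ ?n) * indicator ?B y * (\<integral>\<^sup>+s. (ennreal (s ^ (?n - 1)) * F (s *\<^sub>R y) * indicator {0<..} s) \<partial>lborel)"
        by (rule nn_integral_cmult) measurable
      ultimately show ?thesis by (simp add: mult_ac)
    qed simp
  qed
  also have "\<dots> = (\<integral>\<^sup>+s. \<integral>\<^sup>+y. of_nat ?n * ennreal (norm y ^ ?n) * indicator ?B y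
       * (ennreal (s ^ (?n - 1)) * F (s *\<^sub>R y) * indicator {0<..} s) \<partial>lborel \<partial>lborel)"
    by (rule nn_integral_lborel_swap) measurable
  \<comment> \<open>Substitute \<open>z = s y\<close> for fixed \<open>s\<close>; the unit ball turns into the condition \<open>|z| < s\<close>.\<close>
  also have "\<dots> = (\<integral>\<^sup>+s. \<integral>\<^sup>+z. of_nat ?n * ennreal (norm z ^ ?n) * F z * indicator (- {0}) z
       * (ennreal (1 / s ^ Suc ?n) * indicator {norm z<..} s) \<partial>lborel \<partial>lborel)"
  proof (rule nn_integral_cong)
    fix s :: real
    show "(\<integral>\<^sup>+y. of_nat ?n * ennreal (norm y ^ ?n) * indicator ?B y
       * (ennreal (s ^ (?n - 1)) * F (s *\<^sub>R y) * indicator {0<..} s) \<partial>lborel)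
      = (\<integral>\<^sup>+z. of_nat ?n * ennreal (norm z ^ ?n) * F z * indicator (- {0}) z
       * (ennreal (1 / s ^ Suc ?n) * indicator {norm z<..} s) \<partial>lborel)"
    proof (cases "s > 0")
      case False
      then have "indicator {norm z<..} s = (0::ennreal)" for z :: 'a
        using norm_ge_zero[of z] by (auto simp: indicator_def simp del: norm_ge_zero)
      with False show ?thesis by simp
    next
      case True
      have "(\<integral>\<^sup>+z. of_nat ?n * ennreal (norm z ^ ?n) * F z * indicator (- {0}) z
          * (ennreal (1 / s ^ Suc ?n) * indicator {norm z<..} s) \<partial>lborel)
        = ennreal (\<bar>s\<bar> ^ ?n) * (\<integral>\<^sup>+y. of_nat ?n * ennreal (norm (0 + s *\<^sub>R y) ^ ?n) * F (0 + s *\<^sub>R y) * indicator (- {0}) (0 + s *\<^sub>R y)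
          * (ennreal (1 / s ^ Suc ?n) * indicator {norm (0 + s *\<^sub>R y)<..} s) \<partial>lborel)"
        by (rule nn_integral_lborel_affine) (use True in \<open>auto simp: indicator_def\<close>)
      also have "\<dots> = (\<integral>\<^sup>+y. ennreal (\<bar>s\<bar> ^ ?n) * (of_nat ?n * ennreal (norm (0 + s *\<^sub>R y) ^ ?n) * F (0 + s *\<^sub>R y) * indicator (- {0}) (0 + s *\<^sub>R y)
          * (ennreal (1 / s ^ Suc ?n) * indicator {norm (0 + s *\<^sub>R y)<..} s)) \<partial>lborel)"
        by (subst nn_integral_cmult) (auto simp: indicator_def)
      also have "\<dots> = (\<integral>\<^sup>+y. of_nat ?n * ennreal (norm y ^ ?n) * indicator ?B y
       * (ennreal (s ^ (?n - 1)) * F (s *\<^sub>R y) * indicator {0<..} s) \<partial>lborel)"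
      proof (intro nn_integral_cong)
        fix y :: 'a
        have "s ^ ?n * ((s * norm y) ^ ?n * (1 / s ^ Suc ?n)) = norm y ^ ?n * s ^ (?n - 1)"
          using True by (cases ?n) (simp_all add: power_mult_distrib)
        then have "ennreal (s ^ ?n) * (ennreal ((s * norm y) ^ ?n) * ennreal (1 / s ^ Suc ?n)) = ennreal (norm y ^ ?n) * ennreal (s ^ (?n - 1))"
          using True by (simp flip: ennreal_mult del: times_divide_eq_right)
        from arg_cong[where f="\<lambda>x. x * (of_nat ?n * F (s *\<^sub>R y))", OF this]
        show "ennreal (\<bar>s\<bar> ^ ?n) * (of_nat ?n * ennreal (norm (0 + s *\<^sub>R y) ^ ?n) * F (0 + s *\<^sub>R y) * indicator (- {0}) (0 + s *\<^sub>R y)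
          * (ennreal (1 / s ^ Suc ?n) * indicator {norm (0 + s *\<^sub>R y)<..} s))
          = of_nat ?n * ennreal (norm y ^ ?n) * indicator ?B y
           * (ennreal (s ^ (?n - 1)) * F (s *\<^sub>R y) * indicator {0<..} s)"
          using True by (auto simp: indicator_def mult_ac)
      qed
      finally show ?thesis by simp
    qed
  qed
  also have "\<dots> = (\<integral>\<^sup>+z. \<integral>\<^sup>+s. of_nat ?n * ennreal (norm z ^ ?n) * F z * indicator (- {0}) z
       * (ennreal (1 / s ^ Suc ?n) * indicator {norm z<..} s) \<partial>lborel \<partial>lborel)"
    by (rule nn_integral_lborel_swap) (measurable, simp add: indicator_def)
  also have "\<dots> = (\<integral>\<^sup>+z. F z \<partial>lborel)"
  proof (rule nn_integral_cong_AE)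
    have "AE z in lborel. z \<noteq> (0::'a)" by (rule AE_lborel_singleton)
    then show "AE z in lborel. (\<integral>\<^sup>+s. of_nat ?n * ennreal (norm z ^ ?n) * F z * indicator (- {0}) z
       * (ennreal (1 / s ^ Suc ?n) * indicator {norm z<..} s) \<partial>lborel) = F z"
    proof eventually_elim
      fix z :: 'a assume z: "z \<noteq> 0"
      have "(\<integral>\<^sup>+s. ennreal (1 / s ^ Suc ?n) * indicator {norm z<..} s \<partial>lborel)
          = (\<integral>\<^sup>+s. ennreal (1 / s ^ Suc ?n) * indicator {norm z..} s \<partial>lborel)"
        using AE_lborel_singleton[of "norm z"]
        by (intro nn_integral_cong_AE) (auto simp: indicator_def)
      also have "\<dots> = ennreal (1 / (?n * norm z ^ ?n))"
        using nn_integral_inverse_power_tail[where n="?n" and c="norm z"] z by simp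
      finally have "(\<integral>\<^sup>+s. of_nat ?n * ennreal (norm z ^ ?n) * F z * indicator (- {0}) z
       * (ennreal (1 / s ^ Suc ?n) * indicator {norm z<..} s) \<partial>lborel)
        = of_nat ?n * ennreal (norm z ^ ?n) * F z * ennreal (1 / (?n * norm z ^ ?n))"
        using z by (simp add: nn_integral_cmult)
      also have "\<dots> = ennreal ?n * ennreal (norm z ^ ?n) * ennreal (1 / (?n * norm z ^ ?n)) * F z"
        by (simp add: ennreal_of_nat_eq_real_of_nat mult_ac)
      also have "ennreal ?n * ennreal (norm z ^ ?n) * ennreal (1 / (?n * norm z ^ ?n))
          = ennreal (?n * norm z ^ ?n * (1 / (?n * norm z ^ ?n)))"
        by (subst ennreal_mult[symmetric], simp, simp)+ (rule refl)
      also have "?n * norm z ^ ?n * (1 / (?n * norm z ^ ?n)) = 1"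
        using z by simp
      finally show "(\<integral>\<^sup>+s. of_nat ?n * ennreal (norm z ^ ?n) * F z * indicator (- {0}) z
       * (ennreal (1 / s ^ Suc ?n) * indicator {norm z<..} s) \<partial>lborel) = F z" by simp
    qed
  qed
  finally show ?thesis by simp
qed

section \<open>Potentials of weak-type functions on the sphere\<close>

text \<open>
  The part of the cone over the cap between the radii \<open>1\<close> and \<open>1 + d\<close> lies in the ball of radius
  \<open>2 d\<close> around \<open>\<phi>\<close>, and by polar coordinates its volume is at least \<open>d\<close> times the measure of the cap.
\<close>
lemma spherical_cap_bound:
  fixes \<phi> :: "'a::euclidean_space"
  assumes d: "d > 0"
  shows "emeasure sph {\<theta>. norm (\<phi> - \<theta>) < d}
    \<le> ennreal (2 ^ DIM('a) * measure lborel (ball (0::'a) 1) * d ^ (DIM('a) - 1))"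
proof -
  let ?n = "DIM('a)" and ?cap = "{\<theta>. norm (\<phi> - \<theta>) < d}"
  let ?w = "measure lborel (ball (0::'a) 1)"
  have cap [measurable]: "?cap \<in> sets borel" by measurable
  have "ennreal d * emeasure sph ?cap = (\<integral>\<^sup>+\<theta>. ennreal d * indicator ?cap \<theta> \<partial>sph)"
    by (simp add: nn_integral_cmult_indicator)
  also have "\<dots> = (\<integral>\<^sup>+\<theta>. \<integral>\<^sup>+r. indicator {1<..<1+d} r * indicator ?cap \<theta> \<partial>lborel \<partial>sph)"
    using d by (intro nn_integral_cong) (simp add: nn_integral_multc)
  also have "\<dots> \<le> (\<integral>\<^sup>+\<theta>. \<integral>\<^sup>+r. ennreal (r ^ (?n - 1)) * indicator (ball \<phi> (2 * d)) (r *\<^sub>R \<theta>)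
      * indicator {0<..} r \<partial>lborel \<partial>sph)"
  proof (intro nn_integral_mono_AE)
    show "AE \<theta> in sph. (\<integral>\<^sup>+r. indicator {1<..<1+d} r * indicator ?cap \<theta> \<partial>lborel)
       \<le> (\<integral>\<^sup>+r. ennreal (r ^ (?n - 1)) * indicator (ball \<phi> (2 * d)) (r *\<^sub>R \<theta>)
      * indicator {0<..} r \<partial>lborel)"
      using AE_sph_norm
    proof eventually_elim
      fix \<theta> :: 'a assume \<theta>: "norm \<theta> = 1"
      show "(\<integral>\<^sup>+r. indicator {1<..<1+d} r * indicator ?cap \<theta> \<partial>lborel)
       \<le> (\<integral>\<^sup>+r. ennreal (r ^ (?n - 1)) * indicator (ball \<phi> (2 * d)) (r *\<^sub>R \<theta>)
      * indicator {0<..} r \<partial>lborel)"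
      proof (intro nn_integral_mono)
        fix r :: real
        show "indicator {1<..<1+d} r * indicator ?cap \<theta>
          \<le> ennreal (r ^ (?n - 1)) * indicator (ball \<phi> (2 * d)) (r *\<^sub>R \<theta>) * indicator {0<..} r"
        proof (cases "r \<in> {1<..<1+d} \<and> \<theta> \<in> ?cap")
          case True
          have "norm (\<phi> - r *\<^sub>R \<theta>) \<le> norm (\<phi> - \<theta>) + norm (\<theta> - r *\<^sub>R \<theta>)"
            using norm_triangle_ineq[of "\<phi> - \<theta>" "\<theta> - r *\<^sub>R \<theta>"] by simp
          also have "\<theta> - r *\<^sub>R \<theta> = (1 - r) *\<^sub>R \<theta>" by (simp add: algebra_simps)
          also have "norm (\<phi> - \<theta>) + norm ((1 - r) *\<^sub>R \<theta>) < 2 * d" using True \<theta> by simp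
          finally have "r *\<^sub>R \<theta> \<in> ball \<phi> (2 * d)" by (simp add: dist_norm)
          moreover have "1 \<le> r ^ (?n - 1)" using True by (intro one_le_power) auto
          ultimately show ?thesis using True by simp
        qed auto
      qed
    qed
  qed
  also have "\<dots> = (\<integral>\<^sup>+y. indicator (ball \<phi> (2 * d)) y \<partial>lborel)"
    by (rule polar_coordinates[symmetric]) measurable
  also have "\<dots> = ennreal (measure lborel (ball \<phi> (2 * d)))"
    using emeasure_lborel_ball_finite[of \<phi> "2 * d"] by (simp add: emeasure_eq_ennreal_measure)
  also have "measure lborel (ball \<phi> (2 * d)) = (2 * d) ^ ?n * ?w"
    using d content_ball_conv_unit_ball[of "2 * d" \<phi>] by simp
  finally have "d * measure sph ?cap \<le> (2 * d) ^ ?n * ?w"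
    using d by (simp add: sph.emeasure_eq_measure flip: ennreal_mult)
  also have "\<dots> = d * (2 ^ ?n * ?w * d ^ (?n - 1))"
    by (cases ?n) (simp_all add: power_mult_distrib)
  finally show ?thesis
    using d by (simp add: sph.emeasure_eq_measure)
qed

text \<open>
  Pointwise, \<open>h\<^sup>p\<close> is at most \<open>1\<close> plus the sum of \<open>2\<^bsup>(k+1)p\<^esup>\<close> over the \<open>k\<close> with
  \<open>h > 2\<^sup>k\<close>; the weak bound makes the integrals of the terms a geometric series. It is applied both to
  the kernel \<open>\<Omega>\<close> and to the inverse distance on the sphere.
\<close>
lemma nn_integral_powr_le_of_weak_bound:
  fixes h :: "'b \<Rightarrow> real" and A p s :: real
  assumes h [measurable]: "h \<in> borel_measurable M" and nonneg: "\<And>x. 0 \<le> h x"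
    and p: "0 < p" "p < s" and A: "0 \<le> A"
    and weak: "\<And>k::nat. emeasure M {x\<in>space M. h x > 2 ^ k} \<le> ennreal (A * 2 powr (- (k * s)))"
  shows "(\<integral>\<^sup>+x. ennreal (h x powr p) \<partial>M)
    \<le> emeasure M (space M) + ennreal (A * 2 powr p / (1 - 2 powr (p - s)))"
proof -
  let ?E = "\<lambda>k::nat. {x\<in>space M. h x > 2 ^ k}"
  have q: "0 < 2 powr (p - s)" "2 powr (p - s) < 1"
    using p powr_less_mono[of "p - s" 0 2] by auto
  have pw: "ennreal (h x powr p) \<le> 1 + (\<Sum>k. ennreal (2 powr ((k + 1) * p)) * indicator (?E k) x)"
    if x: "x \<in> space M" for x
  proof (cases "h x \<le> 1")
    case True
    then have "h x powr p \<le> 1" using nonneg[of x] p by (simp add: powr_le1)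
    then have "ennreal (h x powr p) \<le> 1" by simp
    also have "\<dots> \<le> 1 + (\<Sum>k. ennreal (2 powr ((k + 1) * p)) * indicator (?E k) x)" by simp
    finally show ?thesis .
  next
    case False
    obtain m where m: "h x \<le> 2 ^ m" using real_arch_pow[of 2 "h x"] by (auto intro: less_imp_le)
    \<comment> \<open>The dyadic level of the value: \<open>2\<^bsup>j-1\<^esup> < h x \<le> 2\<^sup>j\<close>.\<close>
    define j where "j = (LEAST m. h x \<le> 2 ^ m)"
    have j: "h x \<le> 2 ^ j" unfolding j_def by (rule LeastI[of _ m]) (rule m)
    with False have "j \<noteq> 0" by (cases j) auto
    then obtain k where k: "j = Suc k" by (cases j) auto
    have "\<not> h x \<le> 2 ^ k" using not_less_Least[of k "\<lambda>m. h x \<le> 2 ^ m"] k by (auto simp: j_def)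
    then have "x \<in> ?E k" using x by simp
    have "h x powr p \<le> (2 ^ j) powr p" using j p nonneg by (intro powr_mono2) auto
    also have "(2::real) ^ j = 2 powr (real k + 1)"
      by (subst powr_realpow[symmetric]) (simp_all add: k add.commute)
    also have "(2 powr (real k + 1)) powr p = 2 powr ((k + 1) * p)"
      by (simp add: powr_powr add.commute)
    finally have le: "h x powr p \<le> 2 powr ((k + 1) * p)" .
    define f where "f = (\<lambda>k. ennreal (2 powr ((real k + 1) * p)) * indicator (?E k) x)"
    have "ennreal (h x powr p) \<le> f k"
      using le \<open>x \<in> ?E k\<close> by (simp add: f_def add.commute)
    also have "\<dots> = sum f {k}" by simp
    also have "\<dots> \<le> suminf f"
      by (rule sum_le_suminf) auto
    also have "\<dots> = (\<Sum>k. ennreal (2 powr ((k + 1) * p)) * indicator (?E k) x)"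
      by (simp add: f_def add.commute)
    also have "\<dots> \<le> 1 + \<dots>" by simp
    finally show ?thesis .
  qed
  have "(\<integral>\<^sup>+x. ennreal (h x powr p) \<partial>M)
      \<le> (\<integral>\<^sup>+x. 1 + (\<Sum>k. ennreal (2 powr ((k + 1) * p)) * indicator (?E k) x) \<partial>M)"
    by (intro nn_integral_mono pw)
  also have "\<dots> = emeasure M (space M) + (\<integral>\<^sup>+x. (\<Sum>k. ennreal (2 powr ((k + 1) * p)) * indicator (?E k) x) \<partial>M)"
    by (subst nn_integral_add) auto
  also have "(\<integral>\<^sup>+x. (\<Sum>k. ennreal (2 powr ((k + 1) * p)) * indicator (?E k) x) \<partial>M)
      = (\<Sum>k. ennreal (2 powr ((k + 1) * p)) * emeasure M (?E k))"
    by (subst nn_integral_suminf) (auto simp: nn_integral_cmult_indicator)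
  also have "\<dots> \<le> (\<Sum>k. ennreal (A * 2 powr p * (2 powr (p - s)) ^ k))"
  proof (intro suminf_le)
    fix k :: nat
    have "ennreal (2 powr ((k + 1) * p)) * emeasure M (?E k)
        \<le> ennreal (2 powr ((k + 1) * p)) * ennreal (A * 2 powr (- (k * s)))"
      by (intro mult_left_mono weak) auto
    also have "\<dots> = ennreal (A * (2 powr ((k + 1) * p) * 2 powr (- (k * s))))"
      using A by (simp flip: ennreal_mult add: mult_ac)
    also have "2 powr ((k + 1) * p) * 2 powr (- (k * s)) = 2 powr p * (2 powr (p - s)) ^ k"
      by (simp add: powr_powr flip: powr_realpow powr_add) (simp add: algebra_simps)
    finally show "ennreal (2 powr ((k + 1) * p)) * emeasure M (?E k)
        \<le> ennreal (A * 2 powr p * (2 powr (p - s)) ^ k)" by (simp add: mult.assoc)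
  qed auto
  also have "\<dots> = ennreal (\<Sum>k. A * 2 powr p * (2 powr (p - s)) ^ k)"
    using A q by (intro suminf_ennreal2) (auto intro!: summable_mult summable_geometric)
  also have "(\<Sum>k. A * 2 powr p * (2 powr (p - s)) ^ k) = A * 2 powr p / (1 - 2 powr (p - s))"
    using q by (subst suminf_mult) (auto simp: suminf_geometric summable_geometric)
  finally show ?thesis by simp
qed

text \<open>
  Two constraints fix the exponent. It must exceed \<open>n - 2\<close>, so that the remaining factor
  \<open>(1 - \<rho>)\<^bsup>-(n-1-g)\<^esup>\<close> of the Riesz kernel is integrable in the radius, and it must be smaller than
  \<open>n - 2 + 1 / n = (n - 1)\<^sup>2 / n\<close>, so that the kernel on the sphere pairs with weak \<open>L\<^sup>n\<close>.
\<close>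
definition cap_exponent :: "nat \<Rightarrow> real" where
  "cap_exponent n = n - 2 + 1 / (2 * n)"

text \<open>
  The value on the diagonal is \<open>\<infinity>\<close> because \<open>0 powr a = 0\<close>: with the finite value
  \<open>0\<close> the pointwise domination of the Riesz kernel would fail there.
\<close>
definition cap_kernel :: "'a::euclidean_space \<Rightarrow> 'a \<Rightarrow> ennreal" where
  "cap_kernel \<phi> \<theta> =
     (if \<phi> = \<theta> then \<infinity> else ennreal (norm (\<phi> - \<theta>) powr (- cap_exponent DIM('a))))"

lemma cap_kernel_measurable [measurable (raw)]:
  fixes f g :: "'b \<Rightarrow> 'a::euclidean_space"
  assumes [measurable]: "f \<in> borel_measurable M" "g \<in> borel_measurable M"
  shows "(\<lambda>x. cap_kernel (f x) (g x)) \<in> borel_measurable M"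
  unfolding cap_kernel_def by measurable

text \<open>
  Dividing by the weak norm \<open>N\<close> normalises the tail bound to \<open>2\<^bsup>-kn\<^esup>\<close> at height \<open>2\<^sup>k\<close>, so the
  resulting constant depends only on \<open>p\<close> and the dimension.
\<close>
lemma weak_bound_sph_powr:
  fixes P :: "'a::euclidean_space \<Rightarrow> real" and N p :: real
  assumes P [measurable]: "P \<in> borel_measurable borel" and N: "N > 0"
    and weak: "\<And>t. t > 0 \<Longrightarrow> t * measure sph {\<theta>. \<bar>P \<theta>\<bar> > t} powr (1 / DIM('a)) \<le> N"
    and p: "0 < p" "p < DIM('a)"
  shows "(\<integral>\<^sup>+\<theta>. ennreal ((\<bar>P \<theta>\<bar> / N) powr p) \<partial>sph)
    \<le> emeasure (sph :: 'a measure) UNIV + ennreal (2 powr p / (1 - 2 powr (p - DIM('a))))"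
proof -
  have "(\<integral>\<^sup>+\<theta>. ennreal ((\<bar>P \<theta>\<bar> / N) powr p) \<partial>sph)
    \<le> emeasure sph (space (sph :: 'a measure)) + ennreal (1 * 2 powr p / (1 - 2 powr (p - DIM('a))))"
  proof (rule nn_integral_powr_le_of_weak_bound)
    fix k :: nat
    let ?m = "measure sph {\<theta>. \<bar>P \<theta>\<bar> > N * 2 ^ k}"
    have e: "{x \<in> space sph. 2 ^ k < \<bar>P x\<bar> / N} = {\<theta>. \<bar>P \<theta>\<bar> > N * 2 ^ k}"
      using N by (auto simp: field_simps)
    have "N * 2 ^ k * ?m powr (1 / DIM('a)) \<le> N" using N by (intro weak) auto
    then have "?m powr (1 / DIM('a)) \<le> 1 / 2 ^ k" using N by (simp add: field_simps)
    also have "1 / 2 ^ k = 2 powr (- real k)" by (simp add: powr_minus powr_realpow field_simps)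
    finally have "(?m powr (1 / DIM('a))) powr DIM('a) \<le> (2 powr (- real k)) powr DIM('a)"
      by (intro powr_mono2) auto
    then have "?m \<le> 2 powr (- (k * real DIM('a)))"
      by (simp add: powr_powr)
    then show "emeasure sph {x \<in> space sph. 2 ^ k < \<bar>P x\<bar> / N} \<le> ennreal (1 * 2 powr (- (k * real DIM('a))))"
      unfolding e by (simp add: sph.emeasure_eq_measure)
  qed (use N p in auto)
  then show ?thesis by simp
qed

lemma inverse_distance_sph_powr:
  fixes \<phi> :: "'a::euclidean_space" and p :: real
  assumes p: "0 < p" "p < DIM('a) - 1"
  shows "(\<integral>\<^sup>+\<theta>. ennreal ((1 / norm (\<phi> - \<theta>)) powr p) \<partial>sph)
    \<le> emeasure (sph :: 'a measure) UNIV
      + ennreal (2 ^ DIM('a) * measure lborel (ball (0::'a) 1) * 2 powr p / (1 - 2 powr (p - (DIM('a) - 1))))"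
proof -
  let ?A = "2 ^ DIM('a) * measure lborel (ball (0::'a) 1)"
  have "(\<integral>\<^sup>+\<theta>. ennreal ((1 / norm (\<phi> - \<theta>)) powr p) \<partial>sph)
    \<le> emeasure sph (space (sph :: 'a measure)) + ennreal (?A * 2 powr p / (1 - 2 powr (p - real (DIM('a) - 1))))"
  proof (rule nn_integral_powr_le_of_weak_bound)
    fix k :: nat
    have "emeasure sph {\<theta> \<in> space sph. 2 ^ k < 1 / norm (\<phi> - \<theta>)} \<le> emeasure sph {\<theta>. norm (\<phi> - \<theta>) < 1 / 2 ^ k}"
    proof (rule emeasure_mono)
      show "{\<theta> \<in> space sph. 2 ^ k < 1 / norm (\<phi> - \<theta>)} \<subseteq> {\<theta>. norm (\<phi> - \<theta>) < 1 / 2 ^ k}"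
      proof safe
        fix \<theta> assume a: "2 ^ k < 1 / norm (\<phi> - \<theta>)"
        then have "norm (\<phi> - \<theta>) > 0" by (cases "\<phi> = \<theta>") auto
        with a show "norm (\<phi> - \<theta>) < 1 / 2 ^ k" by (simp add: field_simps)
      qed
    qed measurable
    also have "\<dots> \<le> ennreal (?A * (1 / 2 ^ k) ^ (DIM('a) - 1))"
      by (rule spherical_cap_bound) simp
    also have "(1 / 2 ^ k :: real) ^ (DIM('a) - 1) = 2 powr (- (k * real (DIM('a) - 1)))"
      unfolding of_nat_mult[symmetric] powr_minus powr_realpow[OF zero_less_numeral]
      by (simp add: power_divide power_mult divide_inverse power_inverse)
    finally show "emeasure sph {\<theta> \<in> space sph. 2 ^ k < 1 / norm (\<phi> - \<theta>)} \<le> ennreal (?A * 2 powr (- (k * real (DIM('a) - 1))))" .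
  qed (use p in \<open>auto simp: of_nat_diff\<close>)
  then show ?thesis by (simp add: of_nat_diff)
qed

lemma AE_sph_neq: 
  fixes \<phi> :: "'a::euclidean_space"
  assumes "2 \<le> DIM('a)"
  shows "AE \<theta> in sph. \<theta> \<noteq> \<phi>"
proof (rule AE_I[where N="{\<phi>}"])
  let ?A = "2 ^ DIM('a) * measure lborel (ball (0::'a) 1)"
  have "emeasure sph {\<phi>} \<le> ennreal (?A * (1 / Suc k))" for k
  proof -
    have "emeasure sph {\<phi>} \<le> emeasure sph {\<theta>. norm (\<phi> - \<theta>) < 1 / Suc k}"
      by (rule emeasure_mono) auto
    also have "\<dots> \<le> ennreal (?A * (1 / Suc k) ^ (DIM('a) - 1))"
      by (rule spherical_cap_bound) simp
    also have "\<dots> \<le> ennreal (?A * (1 / Suc k) ^ 1)"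
      using assms by (intro ennreal_leI mult_left_mono power_decreasing) auto
    finally show ?thesis by simp
  qed
  moreover have "(\<lambda>k. ennreal (?A * (1 / Suc k))) \<longlonglongrightarrow> ennreal (?A * 0)"
    by (intro tendsto_ennrealI tendsto_mult tendsto_const LIMSEQ_Suc[OF lim_1_over_n])
  ultimately have "emeasure sph {\<phi>} \<le> ennreal (?A * 0)"
    by (intro LIMSEQ_le_const) auto
  then show "emeasure sph {\<phi>} = 0" by simp
qed auto

text \<open>
  Young's inequality with \<open>p = n - 1/2 < n\<close> splits the product into \<open>|P / N|\<^sup>p\<close>, integrable by the weak
  bound, and the power \<open>g q\<close> of the inverse distance with the conjugate exponent \<open>q\<close>, integrable because
  \<open>g q < n - 1\<close>, the dimension of the sphere. Both bounds are uniform in \<open>\<phi>\<close>.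
\<close>
lemma cap_potential_bound:
  assumes n: "2 \<le> DIM('a)"
  shows "\<exists>C>0. \<forall>(P :: 'a::euclidean_space \<Rightarrow> real) N \<phi>. P \<in> borel_measurable borel \<longrightarrow> 0 \<le> N \<longrightarrow>
    (\<forall>t>0. t * measure sph {\<theta>. \<bar>P \<theta>\<bar> > t} powr (1 / DIM('a)) \<le> N) \<longrightarrow>
    (\<integral>\<^sup>+\<theta>. ennreal \<bar>P \<theta>\<bar> * cap_kernel \<phi> \<theta> \<partial>sph) \<le> ennreal (C * N)"
proof -
  let ?n = "real DIM('a)"
  define g where "g = cap_exponent DIM('a)"
  define p where "p = ?n - 1 / 2"
  define q where "q = (2 * ?n - 1) / (2 * ?n - 3)"
  have n2: "2 \<le> ?n" using n by simp
  have "1 / p + 1 / q = 2 / (2 * ?n - 1) + (2 * ?n - 3) / (2 * ?n - 1)"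
    using n2 by (simp add: p_def q_def field_simps)
  also have "\<dots> = 1" using n2 by (simp flip: add_divide_distrib)
  finally have pq: "1 < p" "p < ?n" "1 < q" "1 / p + 1 / q = 1"
    using n2 by (auto simp: p_def q_def field_simps)
  have g0: "0 < g" unfolding g_def cap_exponent_def using n2 by (intro add_nonneg_pos) auto
  have gq: "g * q < ?n - 1"
  proof -
    have "g * (2 * ?n - 1) < (?n - 1) * (2 * ?n - 3)"
      using n by (simp add: g_def cap_exponent_def field_simps)
    then show ?thesis using n by (simp add: q_def field_simps)
  qed
  define C1 where "C1 = ?n * measure lborel (ball (0::'a) 1) + 2 powr p / (1 - 2 powr (p - ?n))"
  define C2 where "C2 = ?n * measure lborel (ball (0::'a) 1)
     + 2 ^ DIM('a) * measure lborel (ball (0::'a) 1) * 2 powr (g * q) / (1 - 2 powr (g * q - (?n - 1)))"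
  have one: "2 powr (p - ?n) < 1" "2 powr (g * q - (?n - 1)) < 1"
    using pq gq powr_less_mono[of "p - ?n" 0 2] powr_less_mono[of "g * q - (?n - 1)" 0 2] by auto
  have w: "measure lborel (ball (0::'a) 1) > 0" using content_ball_pos[of 1 "0::'a"] by simp
  have C1: "0 < C1" using w one unfolding C1_def by (intro add_pos_pos) auto
  have C2: "0 < C2" using w one unfolding C2_def by (intro add_pos_pos) auto
  have main: "(\<integral>\<^sup>+\<theta>. ennreal \<bar>P \<theta>\<bar> * cap_kernel \<phi> \<theta> \<partial>sph) \<le> ennreal ((C1 + C2) * N)"
    if P [measurable]: "P \<in> borel_measurable borel" and N: "0 < N"
      and weak: "\<And>t. t > 0 \<Longrightarrow> t * measure sph {\<theta>. \<bar>P \<theta>\<bar> > t} powr (1 / DIM('a)) \<le> N"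
    for P :: "'a \<Rightarrow> real" and N \<phi>
  proof -
    have "(\<integral>\<^sup>+\<theta>. ennreal \<bar>P \<theta>\<bar> * cap_kernel \<phi> \<theta> \<partial>sph)
      \<le> (\<integral>\<^sup>+\<theta>. ennreal N * (ennreal ((\<bar>P \<theta>\<bar> / N) powr p) + ennreal ((1 / norm (\<phi> - \<theta>)) powr (g * q))) \<partial>sph)"
    proof (rule nn_integral_mono_AE)
      show "AE \<theta> in sph. ennreal \<bar>P \<theta>\<bar> * cap_kernel \<phi> \<theta>
        \<le> ennreal N * (ennreal ((\<bar>P \<theta>\<bar> / N) powr p) + ennreal ((1 / norm (\<phi> - \<theta>)) powr (g * q)))"
        using AE_sph_neq[OF n, of \<phi>]
      proof eventually_elim
        fix \<theta> assume ne: "\<theta> \<noteq> \<phi>"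
        define b where "b = (1 / norm (\<phi> - \<theta>)) powr g"
        have "(\<bar>P \<theta>\<bar> / N) * b \<le> (\<bar>P \<theta>\<bar> / N) powr p / p + b powr q / q"
          using pq N by (intro Youngs_inequality) (auto simp: b_def)
        also have "\<dots> \<le> (\<bar>P \<theta>\<bar> / N) powr p / 1 + b powr q / 1"
          using pq by (intro add_mono divide_left_mono) auto
        also have "b powr q = (1 / norm (\<phi> - \<theta>)) powr (g * q)"
          unfolding b_def by (simp add: powr_powr)
        finally have "N * ((\<bar>P \<theta>\<bar> / N) * b) \<le> N * ((\<bar>P \<theta>\<bar> / N) powr p + (1 / norm (\<phi> - \<theta>)) powr (g * q))"
          using N by (intro mult_left_mono) auto
        moreover have "N * ((\<bar>P \<theta>\<bar> / N) * b) = \<bar>P \<theta>\<bar> * b" using N by simp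
        moreover have "b = norm (\<phi> - \<theta>) powr (- g)"
          by (simp add: b_def powr_divide powr_minus field_simps)
        ultimately have "\<bar>P \<theta>\<bar> * norm (\<phi> - \<theta>) powr (- g) \<le> N * ((\<bar>P \<theta>\<bar> / N) powr p + (1 / norm (\<phi> - \<theta>)) powr (g * q))"
          by simp
        from ennreal_leI[OF this] show "ennreal \<bar>P \<theta>\<bar> * cap_kernel \<phi> \<theta>
          \<le> ennreal N * (ennreal ((\<bar>P \<theta>\<bar> / N) powr p) + ennreal ((1 / norm (\<phi> - \<theta>)) powr (g * q)))"
          using ne N by (simp add: cap_kernel_def ennreal_mult flip: g_def)
      qed
    qed
    also have "\<dots> = ennreal N * ((\<integral>\<^sup>+\<theta>. ennreal ((\<bar>P \<theta>\<bar> / N) powr p) \<partial>sph) + (\<integral>\<^sup>+\<theta>. ennreal ((1 / norm (\<phi> - \<theta>)) powr (g * q)) \<partial>sph))"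
      by (simp add: nn_integral_cmult nn_integral_add)
    also have "\<dots> \<le> ennreal N * (ennreal C1 + ennreal C2)"
    proof (intro mult_left_mono add_mono)
      have "(\<integral>\<^sup>+\<theta>. ennreal ((\<bar>P \<theta>\<bar> / N) powr p) \<partial>sph) \<le> emeasure (sph :: 'a measure) UNIV + ennreal (2 powr p / (1 - 2 powr (p - DIM('a))))"
        using pq by (intro weak_bound_sph_powr N weak) auto
      also have "\<dots> = ennreal C1"
        unfolding C1_def emeasure_sph_UNIV using one by (subst ennreal_plus) auto
      finally show "(\<integral>\<^sup>+\<theta>. ennreal ((\<bar>P \<theta>\<bar> / N) powr p) \<partial>sph) \<le> ennreal C1" .
      have "(\<integral>\<^sup>+\<theta>. ennreal ((1 / norm (\<phi> - \<theta>)) powr (g * q)) \<partial>sph) \<le> emeasure (sph :: 'a measure) UNIV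
        + ennreal (2 ^ DIM('a) * measure lborel (ball (0::'a) 1) * 2 powr (g * q) / (1 - 2 powr (g * q - (DIM('a) - 1))))"
        using g0 gq pq by (intro inverse_distance_sph_powr) auto
      also have "\<dots> = ennreal C2"
        unfolding C2_def emeasure_sph_UNIV using one by (subst ennreal_plus) auto
      finally show "(\<integral>\<^sup>+\<theta>. ennreal ((1 / norm (\<phi> - \<theta>)) powr (g * q)) \<partial>sph) \<le> ennreal C2" .
    qed auto
    also have "\<dots> = ennreal ((C1 + C2) * N)"
      using C1 C2 N by (simp add: ennreal_mult less_imp_le mult.commute)
    finally show ?thesis .
  qed
  show ?thesis
  proof (intro exI[of _ "C1 + C2"] conjI allI impI)
    show "0 < C1 + C2" using C1 C2 by simp
    fix P :: "'a \<Rightarrow> real" and N :: real and \<phi> :: 'a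
    assume P: "P \<in> borel_measurable borel" and N: "0 \<le> N"
      and weak: "\<forall>t>0. t * measure sph {\<theta>. \<bar>P \<theta>\<bar> > t} powr (1 / DIM('a)) \<le> N"
    \<comment> \<open>The division by \<open>N\<close> needs \<open>N > 0\<close>; the case \<open>N = 0\<close> is reached in the limit.\<close>
    have "(\<integral>\<^sup>+\<theta>. ennreal \<bar>P \<theta>\<bar> * cap_kernel \<phi> \<theta> \<partial>sph) \<le> ennreal ((C1 + C2) * (N + 1 / Suc k))" for k
    proof (rule main[OF P])
      show "0 < N + 1 / Suc k" using N by (simp add: add_nonneg_pos)
      show "t * measure sph {\<theta>. \<bar>P \<theta>\<bar> > t} powr (1 / DIM('a)) \<le> N + 1 / Suc k" if "t > 0" for t
        using weak[rule_format, OF that] by (rule order_trans) simp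
    qed
    moreover have "(\<lambda>k. ennreal ((C1 + C2) * (N + 1 / Suc k))) \<longlonglongrightarrow> ennreal ((C1 + C2) * (N + 0))"
      by (intro tendsto_ennrealI tendsto_mult tendsto_add tendsto_const LIMSEQ_Suc[OF lim_1_over_n])
    ultimately show "(\<integral>\<^sup>+\<theta>. ennreal \<bar>P \<theta>\<bar> * cap_kernel \<phi> \<theta> \<partial>sph) \<le> ennreal ((C1 + C2) * N)"
      by (intro LIMSEQ_le_const) auto
  qed
qed

section \<open>From segments to a Riesz kernel on the unit ball\<close>

lemma nn_integral_interval_FTC:
  fixes f F :: "real \<Rightarrow> real" and a b :: ereal
  assumes "a < b"
  assumes "\<And>x. a < ereal x \<Longrightarrow> ereal x < b \<Longrightarrow> DERIV F x :> f x"
  assumes "\<And>x. a < ereal x \<Longrightarrow> ereal x < b \<Longrightarrow> isCont f x"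
  assumes nonneg: "\<And>x. a < ereal x \<Longrightarrow> ereal x < b \<Longrightarrow> 0 \<le> f x"
  assumes "((F \<circ> real_of_ereal) \<longlongrightarrow> A) (at_right a)"
  assumes "((F \<circ> real_of_ereal) \<longlongrightarrow> B) (at_left b)"
  shows "(\<integral>\<^sup>+x. ennreal (f x) * indicator (einterval a b) x \<partial>lborel) = ennreal (B - A)"
proof -
  note * = interval_integral_FTC_nonneg[OF assms(1-3) _ assms(5,6)]
  have int: "set_integrable lborel (einterval a b) f" and eq: "(LBINT x=a..b. f x) = B - A"
    using * nonneg by auto
  have "(\<integral>\<^sup>+x. ennreal (f x) * indicator (einterval a b) x \<partial>lborel)
      = (\<integral>\<^sup>+x. ennreal (indicator (einterval a b) x *\<^sub>R f x) \<partial>lborel)"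
    by (intro nn_integral_cong) (auto simp: indicator_def)
  also have "\<dots> = ennreal (integral\<^sup>L lborel (\<lambda>x. indicator (einterval a b) x *\<^sub>R f x))"
    using int nonneg unfolding set_integrable_def
    by (intro nn_integral_eq_integral) (auto simp: indicator_def einterval_def)
  also have "integral\<^sup>L lborel (\<lambda>x. indicator (einterval a b) x *\<^sub>R f x) = B - A"
    using eq less_imp_le[OF \<open>a < b\<close>]
    by (simp add: interval_lebesgue_integral_def set_lebesgue_integral_def)
  finally show ?thesis .
qed

text \<open>
  The radial integral that consumes the singularity at the unit sphere; \<open>a < 1\<close> makes it converge at
  \<open>r = v\<close>.
\<close>
lemma nn_integral_radial_singularity:
  fixes v a :: real
  assumes v: "v > 0" and a: "0 < a" "a < 1"
  shows "(\<integral>\<^sup>+r. ennreal ((1 - v / r) powr (- a) / r\<^sup>2) * indicator {v<..} r \<partial>lborel)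
    = ennreal (1 / ((1 - a) * v))"
proof -
  have "(\<integral>\<^sup>+r. ennreal ((1 - v / r) powr (- a) / r\<^sup>2) * indicator (einterval (ereal v) \<infinity>) r \<partial>lborel)
      = ennreal (1 / ((1 - a) * v) - 0)"
  proof (rule nn_integral_interval_FTC)
    fix r assume "ereal v < ereal r"
    then have r: "v < r" "0 < r" "0 < 1 - v / r" using v by auto
    have "DERIV (\<lambda>r. 1 - v / r) r :> v / r\<^sup>2"
      using r by (auto intro!: derivative_eq_intros simp: power2_eq_square)
    then have "DERIV (\<lambda>r. (1 - v / r) powr (1 - a)) r :> (1 - a) * (1 - v / r) powr (1 - a - 1) * (v / r\<^sup>2)"
      using r DERIV_fun_powr[of "\<lambda>r. 1 - v / r" "v / r\<^sup>2" r "1 - a"] by simp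
    then have "DERIV (\<lambda>r. (1 - v / r) powr (1 - a) / ((1 - a) * v)) r
        :> (1 - a) * (1 - v / r) powr (1 - a - 1) * (v / r\<^sup>2) / ((1 - a) * v)"
      by (rule DERIV_cdivide)
    also have "(1 - a) * (1 - v / r) powr (1 - a - 1) * (v / r\<^sup>2) / ((1 - a) * v) = (1 - v / r) powr (- a) / r\<^sup>2"
      using v a by simp
    finally show "DERIV (\<lambda>r. (1 - v / r) powr (1 - a) / ((1 - a) * v)) r :> (1 - v / r) powr (- a) / r\<^sup>2" .
    show "isCont (\<lambda>r. (1 - v / r) powr (- a) / r\<^sup>2) r"
      using r by (intro continuous_intros) auto
    show "0 \<le> (1 - v / r) powr (- a) / r\<^sup>2" by simp
  next
    have "((\<lambda>r. (1 - v / r) powr (1 - a) / ((1 - a) * v)) \<longlongrightarrow> (1 - v / v) powr (1 - a) / ((1 - a) * v)) (at_right v)"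
      using v a by (intro tendsto_intros tendsto_powr') (auto simp: eventually_at_filter)
    then show "(((\<lambda>r. (1 - v / r) powr (1 - a) / ((1 - a) * v)) \<circ> real_of_ereal) \<longlongrightarrow> 0) (at_right (ereal v))"
      using v by (simp add: ereal_tendsto_simps)
    have "((\<lambda>r. (1 - v / r) powr (1 - a) / ((1 - a) * v)) \<longlongrightarrow> (1 - 0) powr (1 - a) / ((1 - a) * v)) at_top"
      using v a by (intro tendsto_intros tendsto_divide_0[OF tendsto_const]
        filterlim_at_top_imp_at_infinity filterlim_ident) auto
    then show "(((\<lambda>r. (1 - v / r) powr (1 - a) / ((1 - a) * v)) \<circ> real_of_ereal) \<longlongrightarrow> 1 / ((1 - a) * v)) (at_left \<infinity>)"
      by (simp add: ereal_tendsto_simps)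
  qed simp
  moreover have "einterval (ereal v) \<infinity> = {v<..}" by (auto simp: einterval_def)
  ultimately show ?thesis by simp
qed

text \<open>
  The classical passage from line integrals to a potential. For fixed \<open>s\<close> substitute
  \<open>u = \<theta> + s (z - \<theta>)\<close>, which stays in the unit ball by convexity; then
  \<open>|u - \<theta>| = s |z - \<theta>| \<le> 2 s\<close>. So \<open>s\<close> runs over \<open>s \<ge> |u - \<theta>| / 2\<close> only.
  The Jacobian and \<open>|z - \<theta>| = |u - \<theta>| / s\<close> contribute \<open>s\<^bsup>-n-1\<^esup>\<close>, whose integral over this
  range gives the kernel.
\<close>
lemma subrepresentation_bound:
  fixes H :: "'a::euclidean_space \<Rightarrow> ennreal"
  assumes H [measurable]: "H \<in> borel_measurable borel" and \<theta>: "norm \<theta> = 1"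
  shows "(\<integral>\<^sup>+s. (\<integral>\<^sup>+z. ennreal (norm (z - \<theta>)) * H (\<theta> + s *\<^sub>R (z - \<theta>)) * indicator (ball 0 1) z \<partial>lborel)
        * indicator {0<..<1} s \<partial>lborel)
    \<le> (\<integral>\<^sup>+u. ennreal (2 ^ DIM('a) / DIM('a) * (1 / norm (u - \<theta>) ^ (DIM('a) - 1))) * H u
        * indicator (ball 0 1) u \<partial>lborel)"
proof -
  let ?n = "DIM('a)"
  have "(\<integral>\<^sup>+s. (\<integral>\<^sup>+z. ennreal (norm (z - \<theta>)) * H (\<theta> + s *\<^sub>R (z - \<theta>)) * indicator (ball 0 1) z \<partial>lborel)
        * indicator {0<..<1} s \<partial>lborel)
    \<le> (\<integral>\<^sup>+s. \<integral>\<^sup>+u. ennreal (norm (u - \<theta>)) * H u * indicator (ball 0 1) u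
         * (ennreal (1 / s ^ Suc ?n) * indicator {norm (u - \<theta>) / 2..} s) \<partial>lborel \<partial>lborel)"
  proof (rule nn_integral_mono)
    fix s :: real
    show "(\<integral>\<^sup>+z. ennreal (norm (z - \<theta>)) * H (\<theta> + s *\<^sub>R (z - \<theta>)) * indicator (ball 0 1) z \<partial>lborel)
        * indicator {0<..<1} s
      \<le> (\<integral>\<^sup>+u. ennreal (norm (u - \<theta>)) * H u * indicator (ball 0 1) u
         * (ennreal (1 / s ^ Suc ?n) * indicator {norm (u - \<theta>) / 2..} s) \<partial>lborel)" (is "_ \<le> ?R")
    proof (cases "0 < s \<and> s < 1")
      case True
      then have s: "0 < s" "s < 1" by auto
      let ?u = "\<lambda>z. (\<theta> - s *\<^sub>R \<theta>) + s *\<^sub>R z"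
      have "(\<integral>\<^sup>+z. ennreal (norm (z - \<theta>)) * H (\<theta> + s *\<^sub>R (z - \<theta>)) * indicator (ball 0 1) z \<partial>lborel)
        \<le> (\<integral>\<^sup>+z. ennreal (\<bar>s\<bar> ^ ?n) * (ennreal (norm (?u z - \<theta>)) * H (?u z) * indicator (ball 0 1) (?u z)
         * (ennreal (1 / s ^ Suc ?n) * indicator {norm (?u z - \<theta>) / 2..} s)) \<partial>lborel)"
      proof (rule nn_integral_mono)
        fix z :: 'a
        show "ennreal (norm (z - \<theta>)) * H (\<theta> + s *\<^sub>R (z - \<theta>)) * indicator (ball 0 1) z
          \<le> ennreal (\<bar>s\<bar> ^ ?n) * (ennreal (norm (?u z - \<theta>)) * H (?u z) * indicator (ball 0 1) (?u z)
         * (ennreal (1 / s ^ Suc ?n) * indicator {norm (?u z - \<theta>) / 2..} s))"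
        proof (cases "norm z < 1")
          case z: True
          have u: "?u z = \<theta> + s *\<^sub>R (z - \<theta>)" by (simp add: algebra_simps)
          have nu: "norm (?u z - \<theta>) = s * norm (z - \<theta>)" using s unfolding u by simp
          have "norm (?u z) \<le> norm (\<theta> - s *\<^sub>R \<theta>) + norm (s *\<^sub>R z)" by (rule norm_triangle_ineq)
          also have "norm (\<theta> - s *\<^sub>R \<theta>) = norm ((1 - s) *\<^sub>R \<theta>)" by (simp add: algebra_simps)
          also have "\<dots> + norm (s *\<^sub>R z) < (1 - s) + s * 1"
            using s z \<theta> by simp
          finally have b: "norm (?u z) < 1" by simp
          have "norm (z - \<theta>) \<le> 2" using norm_triangle_ineq4[of z \<theta>] z \<theta> by simp
          then have c: "norm (?u z - \<theta>) / 2 \<le> s" unfolding nu using s by simp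
          have "s ^ ?n * (s * norm (z - \<theta>) * (1 / s ^ Suc ?n)) = norm (z - \<theta>)"
            using s by simp
          then have e: "ennreal (s ^ ?n) * (ennreal (s * norm (z - \<theta>)) * ennreal (1 / s ^ Suc ?n)) = ennreal (norm (z - \<theta>))"
            using s by (simp flip: ennreal_mult del: times_divide_eq_right)
          have "ennreal (norm (z - \<theta>)) * H (\<theta> + s *\<^sub>R (z - \<theta>)) =
            ennreal (\<bar>s\<bar> ^ ?n) * (ennreal (norm (?u z - \<theta>)) * H (?u z) * (ennreal (1 / s ^ Suc ?n)))"
            unfolding nu e[symmetric] u using s by (simp add: mult_ac)
          then show ?thesis using z b c by simp
        qed simp
      qed
      also have "\<dots> = ennreal (\<bar>s\<bar> ^ ?n) * (\<integral>\<^sup>+z. ennreal (norm (?u z - \<theta>)) * H (?u z) * indicator (ball 0 1) (?u z)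
         * (ennreal (1 / s ^ Suc ?n) * indicator {norm (?u z - \<theta>) / 2..} s) \<partial>lborel)"
        by (rule nn_integral_cmult) (simp add: indicator_def)
      also have "\<dots> = ?R"
        by (rule nn_integral_lborel_affine[symmetric]) (use s in \<open>auto simp: indicator_def\<close>)
      finally show ?thesis using s by simp
    qed simp
  qed
  also have "\<dots> = (\<integral>\<^sup>+u. \<integral>\<^sup>+s. ennreal (norm (u - \<theta>)) * H u * indicator (ball 0 1) u
         * (ennreal (1 / s ^ Suc ?n) * indicator {norm (u - \<theta>) / 2..} s) \<partial>lborel \<partial>lborel)"
    by (rule nn_integral_lborel_swap) (measurable, simp add: indicator_def)
  also have "\<dots> = (\<integral>\<^sup>+u. ennreal (2 ^ ?n / ?n * (1 / norm (u - \<theta>) ^ (?n - 1))) * H u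
        * indicator (ball 0 1) u \<partial>lborel)"
  proof (rule nn_integral_cong)
    fix u :: 'a
    show "(\<integral>\<^sup>+s. ennreal (norm (u - \<theta>)) * H u * indicator (ball 0 1) u
         * (ennreal (1 / s ^ Suc ?n) * indicator {norm (u - \<theta>) / 2..} s) \<partial>lborel)
      = ennreal (2 ^ ?n / ?n * (1 / norm (u - \<theta>) ^ (?n - 1))) * H u * indicator (ball 0 1) u"
    proof (cases "norm u < 1")
      case True
      then have "u \<noteq> \<theta>" using \<theta> by auto
      then have p: "norm (u - \<theta>) > 0" by simp
      have "(\<integral>\<^sup>+s. ennreal (norm (u - \<theta>)) * H u * indicator (ball 0 1) u
         * (ennreal (1 / s ^ Suc ?n) * indicator {norm (u - \<theta>) / 2..} s) \<partial>lborel)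
        = ennreal (norm (u - \<theta>)) * H u * indicator (ball 0 1) u
         * (\<integral>\<^sup>+s. ennreal (1 / s ^ Suc ?n) * indicator {norm (u - \<theta>) / 2..} s \<partial>lborel)"
        by (rule nn_integral_cmult) measurable
      also have "(\<integral>\<^sup>+s. ennreal (1 / s ^ Suc ?n) * indicator {norm (u - \<theta>) / 2..} s \<partial>lborel)
        = ennreal (1 / (?n * (norm (u - \<theta>) / 2) ^ ?n))"
        using p by (intro nn_integral_inverse_power_tail) auto
      also have "ennreal (norm (u - \<theta>)) * H u * indicator (ball 0 1) u * ennreal (1 / (?n * (norm (u - \<theta>) / 2) ^ ?n))
        = (ennreal (norm (u - \<theta>)) * ennreal (1 / (?n * (norm (u - \<theta>) / 2) ^ ?n))) * H u * indicator (ball 0 1) u"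
        by (simp add: mult_ac)
      also have "ennreal (norm (u - \<theta>)) * ennreal (1 / (?n * (norm (u - \<theta>) / 2) ^ ?n))
        = ennreal (norm (u - \<theta>) * (1 / (?n * (norm (u - \<theta>) / 2) ^ ?n)))"
        by (rule ennreal_mult[symmetric]) auto
      also have "norm (u - \<theta>) * (1 / (?n * (norm (u - \<theta>) / 2) ^ ?n)) = 2 ^ ?n / ?n * (1 / norm (u - \<theta>) ^ (?n - 1))"
      proof -
        have *: "x * (1 / (k * ((x * y) / c))) = c / k * (1 / y)" if "x \<noteq> 0" for x y c k :: real
          using that by (cases "y = 0 \<or> k = 0 \<or> c = 0") (auto simp: field_simps)
        have "norm (u - \<theta>) ^ ?n = norm (u - \<theta>) * norm (u - \<theta>) ^ (?n - 1)"
          by (cases ?n) simp_all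
        then show ?thesis
          using p *[of "norm (u - \<theta>)" "real ?n" "norm (u - \<theta>) ^ (?n - 1)" "2 ^ ?n"]
          by (simp only: power_divide)
      qed
      finally show ?thesis .
    qed simp
  qed
  finally show ?thesis .
qed

text \<open>
  With \<open>\<rho> = |v| / r\<close>, the point \<open>v / r\<close> is \<open>\<rho>\<close> times the direction of \<open>v\<close>, and its distance to
  \<open>\<theta>\<close> is at least \<open>1 - \<rho>\<close> and at least half the distance of the two directions. The exponent
  \<open>n - 1\<close> is shared between these two lower bounds.
\<close>
lemma radial_kernel_bound:
  fixes v \<theta> :: "'a::euclidean_space" and r g :: real
  assumes n: "2 \<le> DIM('a)" and \<theta>: "norm \<theta> = 1" and v: "v \<noteq> 0" "norm v < r" and ne: "sgn v \<noteq> \<theta>"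
  defines "g \<equiv> cap_exponent DIM('a)"
  shows "1 / r ^ DIM('a) * (1 / norm (v /\<^sub>R r - \<theta>) ^ (DIM('a) - 1))
    \<le> 2 powr g * norm (sgn v - \<theta>) powr (- g) / norm v ^ (DIM('a) - 2)
        * ((1 - norm v / r) powr (- (DIM('a) - 1 - g)) / r\<^sup>2)"
proof -
  let ?n = "DIM('a)"
  define a where "a = real ?n - 1 - g"
  have n2: "2 \<le> real ?n" using n by simp
  have a0: "0 \<le> a" using n2 by (simp add: a_def g_def cap_exponent_def field_simps)
  have g0: "0 \<le> g" unfolding g_def cap_exponent_def using n2 by (intro add_nonneg_nonneg) auto
  have vp: "0 < norm v" "0 < r" using v by (auto intro: le_less_trans[OF norm_ge_zero])
  define \<rho> where "\<rho> = norm v / r"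
  have \<rho>: "0 < \<rho>" "\<rho> < 1" using vp v by (auto simp: \<rho>_def)
  have vr: "v /\<^sub>R r = \<rho> *\<^sub>R sgn v" using vp by (simp add: \<rho>_def sgn_div_norm divide_inverse mult_ac)
  define d where "d = norm (v /\<^sub>R r - \<theta>)"
  have d1: "1 - \<rho> \<le> d"
    using norm_triangle_ineq2[of \<theta> "v /\<^sub>R r"] \<theta> \<rho> v
    by (simp add: d_def vr norm_sgn norm_minus_commute)
  have "norm (sgn v - \<theta>) \<le> norm (sgn v - v /\<^sub>R r) + d"
    unfolding d_def using norm_triangle_ineq[of "sgn v - v /\<^sub>R r" "v /\<^sub>R r - \<theta>"] by simp
  also have "sgn v - v /\<^sub>R r = (1 - \<rho>) *\<^sub>R sgn v" by (simp add: vr algebra_simps)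
  also have "norm ((1 - \<rho>) *\<^sub>R sgn v) = 1 - \<rho>" using \<rho> v by (simp add: norm_sgn)
  finally have d2: "norm (sgn v - \<theta>) / 2 \<le> d" using d1 by simp
  have sp: "0 < norm (sgn v - \<theta>) / 2" using ne by simp
  have d0: "0 < d" using d1 \<rho> by simp
  have "1 / d ^ (?n - 1) = d powr (- a) * d powr (- g)"
  proof -
    have "1 / d ^ (?n - 1) = d powr (- real (?n - 1))"
      by (simp only: powr_minus powr_realpow[OF d0] divide_inverse mult_1)
    also have "- real (?n - 1) = - a + - g" using n by (simp add: a_def of_nat_diff)
    finally show ?thesis by (simp only: powr_add)
  qed
  also have "\<dots> \<le> (1 - \<rho>) powr (- a) * (norm (sgn v - \<theta>) / 2) powr (- g)"
    using a0 g0 d1 d2 \<rho> sp by (intro mult_mono powr_mono2') auto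
  also have "(norm (sgn v - \<theta>) / 2) powr (- g) = 2 powr g * norm (sgn v - \<theta>) powr (- g)"
    using sp by (simp add: powr_divide powr_minus field_simps)
  finally have k: "1 / d ^ (?n - 1) \<le> (1 - \<rho>) powr (- a) * (2 powr g * norm (sgn v - \<theta>) powr (- g))" .
  have "1 / r ^ ?n = 1 / r ^ (?n - 2) * (1 / r\<^sup>2)"
  proof -
    have "r ^ ?n = r ^ (?n - 2) * r\<^sup>2"
      using n by (metis le_add_diff_inverse2 power_add)
    then show ?thesis by simp
  qed
  also have "\<dots> \<le> 1 / norm v ^ (?n - 2) * (1 / r\<^sup>2)"
    using vp v by (intro mult_right_mono divide_left_mono power_mono) auto
  finally have "1 / r ^ ?n * (1 / d ^ (?n - 1))
    \<le> (1 / norm v ^ (?n - 2) * (1 / r\<^sup>2)) * ((1 - \<rho>) powr (- a) * (2 powr g * norm (sgn v - \<theta>) powr (- g)))"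
    using k vp d0 by (intro mult_mono) auto
  then show ?thesis by (simp add: d_def \<rho>_def a_def mult_ac)
qed

lemma radial_kernel_integral:
  fixes v \<theta> :: "'a::euclidean_space"
  assumes n: "2 \<le> DIM('a)" and \<theta>: "norm \<theta> = 1" and v: "v \<noteq> 0"
  shows "(\<integral>\<^sup>+r. ennreal (1 / r ^ DIM('a) * (1 / norm (v /\<^sub>R r - \<theta>) ^ (DIM('a) - 1)))
      * indicator {norm v<..} r \<partial>lborel)
    \<le> ennreal (2 powr cap_exponent DIM('a) * (2 * DIM('a)) / norm v ^ (DIM('a) - 1)) * cap_kernel (sgn v) \<theta>"
proof (cases "sgn v = \<theta>")
  case True
  have "0 < 2 powr cap_exponent DIM('a) * (2 * DIM('a)) / norm v ^ (DIM('a) - 1)"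
    using v by simp
  then have "ennreal (2 powr cap_exponent DIM('a) * (2 * DIM('a)) / norm v ^ (DIM('a) - 1)) * cap_kernel (sgn v) \<theta> = top"
    unfolding cap_kernel_def using True v by (simp add: ennreal_mult_top)
  then show ?thesis by (simp only: top_greatest)
next
  case False
  let ?n = "DIM('a)"
  define g where "g = cap_exponent ?n"
  define c where "c = 2 powr g * norm (sgn v - \<theta>) powr (- g) / norm v ^ (?n - 2)"
  have n2: "2 \<le> real ?n" using n by simp
  have a: "0 < real ?n - 1 - g" "real ?n - 1 - g < 1" "1 - (real ?n - 1 - g) = 1 / (2 * ?n)"
    using n2 by (auto simp: g_def cap_exponent_def field_simps)
  have vp: "norm v > 0" using v by simp
  have "(\<integral>\<^sup>+r. ennreal (1 / r ^ ?n * (1 / norm (v /\<^sub>R r - \<theta>) ^ (?n - 1))) * indicator {norm v<..} r \<partial>lborel)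
    \<le> (\<integral>\<^sup>+r. ennreal c * (ennreal ((1 - norm v / r) powr (- (?n - 1 - g)) / r\<^sup>2) * indicator {norm v<..} r) \<partial>lborel)"
  proof (rule nn_integral_mono)
    fix r :: real
    show "ennreal (1 / r ^ ?n * (1 / norm (v /\<^sub>R r - \<theta>) ^ (?n - 1))) * indicator {norm v<..} r
      \<le> ennreal c * (ennreal ((1 - norm v / r) powr (- (?n - 1 - g)) / r\<^sup>2) * indicator {norm v<..} r)"
    proof (cases "norm v < r")
      case True
      then show ?thesis
        using radial_kernel_bound[OF n \<theta> v True False]
        by (simp add: c_def g_def flip: ennreal_mult)
    qed simp
  qed
  also have "\<dots> = ennreal c * ennreal (1 / ((1 - (?n - 1 - g)) * norm v))"
    using nn_integral_radial_singularity[OF vp a(1,2)] by (simp add: nn_integral_cmult)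
  also have "1 / ((1 - (?n - 1 - g)) * norm v) = 2 * ?n / norm v"
    using a(3) by (simp del: diff_diff_eq2 diff_diff_eq)
  also have "ennreal c * ennreal (2 * ?n / norm v) = ennreal (c * (2 * ?n / norm v))"
    by (rule ennreal_mult[symmetric]) (auto simp: c_def)
  also have "c * (2 * ?n / norm v) = 2 powr g * (2 * ?n) / (norm v ^ (?n - 2) * norm v) * norm (sgn v - \<theta>) powr (- g)"
    by (simp add: c_def)
  also have "norm v ^ (?n - 2) * norm v = norm v ^ (?n - 1)"
    using n by (simp flip: power_Suc2 add: Suc_diff_Suc numeral_2_eq_2)
  also have "ennreal (2 powr g * (2 * ?n) / norm v ^ (?n - 1) * norm (sgn v - \<theta>) powr (- g))
    = ennreal (2 powr g * (2 * ?n) / norm v ^ (?n - 1)) * ennreal (norm (sgn v - \<theta>) powr (- g))"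
    by (rule ennreal_mult) auto
  finally show ?thesis using False by (simp add: cap_kernel_def g_def)
qed

text \<open>
  Integrating over all dilations turns a potential on the unit ball with pole \<open>\<theta>\<close> into a homogeneous
  kernel on the whole space: substituting \<open>v = r u\<close> and integrating in \<open>r\<close> first leaves at most the size
  \<open>|v|\<^bsup>1-n\<^esup>\<close> of the Riesz kernel times a function of the direction of \<open>v\<close>. One dimension of
  integration has been gained: on the sphere the exponent is below \<open>n - 1\<close>.
\<close>
lemma dilated_potential_bound:
  fixes G :: "'a::euclidean_space \<Rightarrow> ennreal"
  assumes n: "2 \<le> DIM('a)" and G [measurable]: "G \<in> borel_measurable borel" and \<theta>: "norm \<theta> = 1"
  shows "(\<integral>\<^sup>+r. (\<integral>\<^sup>+u. ennreal (1 / norm (u - \<theta>) ^ (DIM('a) - 1)) * G (r *\<^sub>R u) * indicator (ball 0 1) u \<partial>lborel)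
       * indicator {0<..} r \<partial>lborel)
    \<le> (\<integral>\<^sup>+v. ennreal (2 powr cap_exponent DIM('a) * (2 * DIM('a)) / norm v ^ (DIM('a) - 1)) * G v
         * cap_kernel (sgn v) \<theta> \<partial>lborel)"
proof -
  let ?n = "DIM('a)"
  have "(\<integral>\<^sup>+r. (\<integral>\<^sup>+u. ennreal (1 / norm (u - \<theta>) ^ (?n - 1)) * G (r *\<^sub>R u) * indicator (ball 0 1) u \<partial>lborel)
       * indicator {0<..} r \<partial>lborel)
    = (\<integral>\<^sup>+r. \<integral>\<^sup>+v. G v * (ennreal (1 / r ^ ?n * (1 / norm (v /\<^sub>R r - \<theta>) ^ (?n - 1))) * indicator {norm v<..} r) \<partial>lborel \<partial>lborel)"
  proof (rule nn_integral_cong)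
    fix r :: real
    show "(\<integral>\<^sup>+u. ennreal (1 / norm (u - \<theta>) ^ (?n - 1)) * G (r *\<^sub>R u) * indicator (ball 0 1) u \<partial>lborel)
       * indicator {0<..} r
      = (\<integral>\<^sup>+v. G v * (ennreal (1 / r ^ ?n * (1 / norm (v /\<^sub>R r - \<theta>) ^ (?n - 1))) * indicator {norm v<..} r) \<partial>lborel)"
    proof (cases "r > 0")
      case True
      have "(\<integral>\<^sup>+u. ennreal (1 / norm (u - \<theta>) ^ (?n - 1)) * G (r *\<^sub>R u) * indicator (ball 0 1) u \<partial>lborel)
        = ennreal (\<bar>1 / r\<bar> ^ ?n) * (\<integral>\<^sup>+v. ennreal (1 / norm ((0 + (1 / r) *\<^sub>R v) - \<theta>) ^ (?n - 1)) * G (r *\<^sub>R (0 + (1 / r) *\<^sub>R v)) * indicator (ball 0 1) (0 + (1 / r) *\<^sub>R v) \<partial>lborel)"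
        by (rule nn_integral_lborel_affine) (use True in auto)
      also have "\<dots> = (\<integral>\<^sup>+v. ennreal (\<bar>1 / r\<bar> ^ ?n) * (ennreal (1 / norm ((0 + (1 / r) *\<^sub>R v) - \<theta>) ^ (?n - 1)) * G (r *\<^sub>R (0 + (1 / r) *\<^sub>R v)) * indicator (ball 0 1) (0 + (1 / r) *\<^sub>R v)) \<partial>lborel)"
        by (rule nn_integral_cmult[symmetric]) measurable
      also have "\<dots> = (\<integral>\<^sup>+v. G v * (ennreal (1 / r ^ ?n * (1 / norm (v /\<^sub>R r - \<theta>) ^ (?n - 1))) * indicator {norm v<..} r) \<partial>lborel)"
      proof (rule nn_integral_cong)
        fix v :: 'a
        have i: "indicator (ball 0 1) (0 + (1 / r) *\<^sub>R v) = (indicator {norm v<..} r :: ennreal)"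
          using True by (auto simp: indicator_def field_simps)
        have "ennreal (1 / r ^ ?n * (1 / norm (v /\<^sub>R r - \<theta>) ^ (?n - 1)))
          = ennreal (1 / r ^ ?n) * ennreal (1 / norm (v /\<^sub>R r - \<theta>) ^ (?n - 1))"
          using True by (intro ennreal_mult) auto
        then show "ennreal (\<bar>1 / r\<bar> ^ ?n) * (ennreal (1 / norm ((0 + (1 / r) *\<^sub>R v) - \<theta>) ^ (?n - 1)) * G (r *\<^sub>R (0 + (1 / r) *\<^sub>R v)) * indicator (ball 0 1) (0 + (1 / r) *\<^sub>R v))
          = G v * (ennreal (1 / r ^ ?n * (1 / norm (v /\<^sub>R r - \<theta>) ^ (?n - 1))) * indicator {norm v<..} r)"
          unfolding i using True by (simp add: power_inverse divide_inverse mult_ac)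
      qed
      finally show ?thesis using True by simp
    next
      case False
      then have "indicator {norm v<..} r = (0::ennreal)" for v :: 'a
        using norm_ge_zero[of v] by (auto simp: indicator_def simp del: norm_ge_zero)
      with False show ?thesis by simp
    qed
  qed
  also have "\<dots> = (\<integral>\<^sup>+v. \<integral>\<^sup>+r. G v * (ennreal (1 / r ^ ?n * (1 / norm (v /\<^sub>R r - \<theta>) ^ (?n - 1))) * indicator {norm v<..} r) \<partial>lborel \<partial>lborel)"
    by (rule nn_integral_lborel_swap) (measurable, simp add: indicator_def)
  also have "\<dots> \<le> (\<integral>\<^sup>+v. ennreal (2 powr cap_exponent ?n * (2 * ?n) / norm v ^ (?n - 1)) * G v
         * cap_kernel (sgn v) \<theta> \<partial>lborel)"
  proof (rule nn_integral_mono_AE)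
    show "AE v in lborel. (\<integral>\<^sup>+r. G v * (ennreal (1 / r ^ ?n * (1 / norm (v /\<^sub>R r - \<theta>) ^ (?n - 1))) * indicator {norm v<..} r) \<partial>lborel)
      \<le> ennreal (2 powr cap_exponent ?n * (2 * ?n) / norm v ^ (?n - 1)) * G v * cap_kernel (sgn v) \<theta>"
      using AE_lborel_singleton[of "0::'a"]
    proof eventually_elim
      fix v :: 'a assume v: "v \<noteq> 0"
      have "(\<integral>\<^sup>+r. G v * (ennreal (1 / r ^ ?n * (1 / norm (v /\<^sub>R r - \<theta>) ^ (?n - 1))) * indicator {norm v<..} r) \<partial>lborel)
        = G v * (\<integral>\<^sup>+r. (ennreal (1 / r ^ ?n * (1 / norm (v /\<^sub>R r - \<theta>) ^ (?n - 1))) * indicator {norm v<..} r) \<partial>lborel)"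
        by (rule nn_integral_cmult) measurable
      also have "\<dots> \<le> G v * (ennreal (2 powr cap_exponent ?n * (2 * ?n) / norm v ^ (?n - 1)) * cap_kernel (sgn v) \<theta>)"
        by (intro mult_left_mono radial_kernel_integral n \<theta> v) auto
      finally show "(\<integral>\<^sup>+r. G v * (ennreal (1 / r ^ ?n * (1 / norm (v /\<^sub>R r - \<theta>) ^ (?n - 1))) * indicator {norm v<..} r) \<partial>lborel)
        \<le> ennreal (2 powr cap_exponent ?n * (2 * ?n) / norm v ^ (?n - 1)) * G v * cap_kernel (sgn v) \<theta>"
        by (simp add: mult_ac)
    qed
  qed
  finally show ?thesis .
qed

section \<open>The truncated integral and the Riesz potential of the gradient\<close>

lemma nn_integral_radial_product:
  fixes A :: "'a::euclidean_space \<Rightarrow> ennreal" and B :: "real \<Rightarrow> ennreal"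
  assumes [measurable]: "A \<in> borel_measurable borel" "B \<in> borel_measurable borel"
  shows "(\<integral>\<^sup>+y. A (sgn y) * B (norm y) \<partial>lborel)
    = (\<integral>\<^sup>+\<theta>. A \<theta> \<partial>sph) * (\<integral>\<^sup>+r. ennreal (r ^ (DIM('a) - 1)) * B r * indicator {0<..} r \<partial>lborel)"
proof -
  let ?I = "\<integral>\<^sup>+r. ennreal (r ^ (DIM('a) - 1)) * B r * indicator {0<..} r \<partial>lborel"
  have "(\<integral>\<^sup>+y. A (sgn y) * B (norm y) \<partial>lborel)
    = (\<integral>\<^sup>+\<theta>. \<integral>\<^sup>+r. ennreal (r ^ (DIM('a) - 1)) * (A (sgn (r *\<^sub>R \<theta>)) * B (norm (r *\<^sub>R \<theta>))) * indicator {0<..} r \<partial>lborel \<partial>sph)"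
    by (rule polar_coordinates) measurable
  also have "\<dots> = (\<integral>\<^sup>+\<theta>. A \<theta> * ?I \<partial>sph)"
  proof (rule nn_integral_cong_AE)
    show "AE \<theta> in sph. (\<integral>\<^sup>+r. ennreal (r ^ (DIM('a) - 1)) * (A (sgn (r *\<^sub>R \<theta>)) * B (norm (r *\<^sub>R \<theta>))) * indicator {0<..} r \<partial>lborel) = A \<theta> * ?I"
      using AE_sph_norm
    proof eventually_elim
      fix \<theta> :: 'a assume \<theta>: "norm \<theta> = 1"
      have "(\<integral>\<^sup>+r. ennreal (r ^ (DIM('a) - 1)) * (A (sgn (r *\<^sub>R \<theta>)) * B (norm (r *\<^sub>R \<theta>))) * indicator {0<..} r \<partial>lborel)
        = (\<integral>\<^sup>+r. A \<theta> * (ennreal (r ^ (DIM('a) - 1)) * B r * indicator {0<..} r) \<partial>lborel)"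
        by (intro nn_integral_cong) (auto simp: indicator_def sgn_div_norm \<theta> mult_ac)
      also have "\<dots> = A \<theta> * ?I" by (rule nn_integral_cmult) measurable
      finally show "(\<integral>\<^sup>+r. ennreal (r ^ (DIM('a) - 1)) * (A (sgn (r *\<^sub>R \<theta>)) * B (norm (r *\<^sub>R \<theta>))) * indicator {0<..} r \<partial>lborel) = A \<theta> * ?I" .
    qed
  qed
  also have "\<dots> = (\<integral>\<^sup>+\<theta>. A \<theta> \<partial>sph) * ?I" by (rule nn_integral_multc) simp
  finally show ?thesis .
qed

text \<open>
  The positive and the negative part of the integrand are sums of products of a function of the
  direction and a function of the radius. By polar coordinates the two parts have equal integrals, as the
  positive and negative parts of \<open>P\<close> have the same mass on the sphere.
\<close>
lemma integral_mean_zero_times_radial: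
  fixes P :: "'a::euclidean_space \<Rightarrow> real" and \<psi> :: "real \<Rightarrow> real"
  assumes [measurable]: "P \<in> borel_measurable borel" "\<psi> \<in> borel_measurable borel"
    and mean: "(\<integral>\<^sup>+\<theta>. ennreal (P \<theta>) \<partial>sph) = (\<integral>\<^sup>+\<theta>. ennreal (- P \<theta>) \<partial>sph)"
  shows "(LINT y|lborel. P (sgn y) * \<psi> (norm y)) = 0"
proof (cases "integrable lborel (\<lambda>y. P (sgn y) * \<psi> (norm y))")
  case True
  have split: "ennreal (a * b) = ennreal a * ennreal b + ennreal (- a) * ennreal (- b)" for a b :: real
  proof (cases "a \<ge> 0")
    case a: True
    show ?thesis using a
      by (cases "b \<ge> 0") (auto simp: ennreal_mult ennreal_neg mult_nonneg_nonpos)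
  next
    case a: False
    show ?thesis
    proof (cases "b \<ge> 0")
      case True
      then show ?thesis using a by (auto simp: ennreal_neg mult_nonpos_nonneg)
    next
      case False
      then show ?thesis using a ennreal_mult[of "- a" "- b"] by (auto simp: ennreal_neg)
    qed
  qed
  have "(\<integral>\<^sup>+y. ennreal (P (sgn y) * \<psi> (norm y)) \<partial>lborel)
    = (\<integral>\<^sup>+y. ennreal (P (sgn y)) * ennreal (\<psi> (norm y)) \<partial>lborel) + (\<integral>\<^sup>+y. ennreal (- P (sgn y)) * ennreal (- \<psi> (norm y)) \<partial>lborel)"
    unfolding split by (rule nn_integral_add) measurable
  also have "\<dots> = (\<integral>\<^sup>+y. ennreal (- P (sgn y)) * ennreal (\<psi> (norm y)) \<partial>lborel) + (\<integral>\<^sup>+y. ennreal (- (- P (sgn y))) * ennreal (- \<psi> (norm y)) \<partial>lborel)"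
    using nn_integral_radial_product[of "\<lambda>\<theta>. ennreal (P \<theta>)" "\<lambda>r. ennreal (\<psi> r)"]
      nn_integral_radial_product[of "\<lambda>\<theta>. ennreal (P \<theta>)" "\<lambda>r. ennreal (- \<psi> r)"]
      nn_integral_radial_product[of "\<lambda>\<theta>. ennreal (- P \<theta>)" "\<lambda>r. ennreal (\<psi> r)"]
      nn_integral_radial_product[of "\<lambda>\<theta>. ennreal (- P \<theta>)" "\<lambda>r. ennreal (- \<psi> r)"] mean
    by simp
  also have "\<dots> = (\<integral>\<^sup>+y. ennreal (- (P (sgn y) * \<psi> (norm y))) \<partial>lborel)"
    unfolding minus_mult_left split by (rule nn_integral_add[symmetric]) measurable
  finally have "(\<integral>\<^sup>+y. ennreal (P (sgn y) * \<psi> (norm y)) \<partial>lborel) = (\<integral>\<^sup>+y. ennreal (- (P (sgn y) * \<psi> (norm y))) \<partial>lborel)" .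
  then show ?thesis using True by (simp add: real_lebesgue_integral_def)
qed (rule not_integrable_integral_eq)

lemma integrable_truncated_rough_kernel:
  fixes P u :: "'a::euclidean_space \<Rightarrow> real" and t R M :: real
  assumes [measurable]: "P \<in> borel_measurable borel" "u \<in> borel_measurable borel"
    and P: "(\<integral>\<^sup>+\<theta>. ennreal \<bar>P \<theta>\<bar> \<partial>sph) < \<infinity>"
    and t: "0 < t" and M: "\<And>y. \<bar>u y\<bar> \<le> M" and R: "\<And>y. R \<le> norm y \<Longrightarrow> u y = 0"
  shows "integrable lborel (\<lambda>y. indicator {y. norm y > t} y * (P (sgn y) / norm y ^ DIM('a) * u y))"
proof (rule integrableI_bounded)
  let ?n = "DIM('a)"
  have M0: "0 \<le> M" using M[of 0] by linarith
  have "(\<integral>\<^sup>+y. ennreal (norm (indicator {y. norm y > t} y * (P (sgn y) / norm y ^ ?n * u y))) \<partial>lborel)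
    \<le> (\<integral>\<^sup>+y. ennreal \<bar>P (sgn y)\<bar> * (ennreal (M / norm y ^ ?n) * indicator {t<..<max t R} (norm y)) \<partial>lborel)"
  proof (rule nn_integral_mono)
    fix y :: 'a
    show "ennreal (norm (indicator {y. norm y > t} y * (P (sgn y) / norm y ^ ?n * u y)))
      \<le> ennreal \<bar>P (sgn y)\<bar> * (ennreal (M / norm y ^ ?n) * indicator {t<..<max t R} (norm y))"
    proof (cases "norm y > t \<and> norm y < R")
      case True
      have "\<bar>P (sgn y)\<bar> / norm y ^ ?n * \<bar>u y\<bar> \<le> \<bar>P (sgn y)\<bar> / norm y ^ ?n * M"
        by (intro mult_left_mono M) auto
      then have "\<bar>P (sgn y)\<bar> / norm y ^ ?n * \<bar>u y\<bar> \<le> \<bar>P (sgn y)\<bar> * (M / norm y ^ ?n)" by simp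
      moreover have "ennreal (\<bar>P (sgn y)\<bar> * (M / norm y ^ ?n)) = ennreal \<bar>P (sgn y)\<bar> * ennreal (M / norm y ^ ?n)"
        using M0 by (intro ennreal_mult) auto
      ultimately show ?thesis
        using True ennreal_leI[of "\<bar>P (sgn y)\<bar> / norm y ^ ?n * \<bar>u y\<bar>" "\<bar>P (sgn y)\<bar> * (M / norm y ^ ?n)"]
        by (simp add: abs_mult)
    qed (use R in auto)
  qed
  also have "\<dots> = (\<integral>\<^sup>+\<theta>. ennreal \<bar>P \<theta>\<bar> \<partial>sph) * (\<integral>\<^sup>+r. ennreal (r ^ (?n - 1)) * (ennreal (M / r ^ ?n) * indicator {t<..<max t R} r) * indicator {0<..} r \<partial>lborel)"
    by (rule nn_integral_radial_product) measurable
  also have "\<dots> \<le> (\<integral>\<^sup>+\<theta>. ennreal \<bar>P \<theta>\<bar> \<partial>sph) * (\<integral>\<^sup>+r. ennreal (M / t) * indicator {t<..<max t R} r \<partial>lborel)"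
  proof (intro mult_left_mono nn_integral_mono)
    fix r :: real
    show "ennreal (r ^ (?n - 1)) * (ennreal (M / r ^ ?n) * indicator {t<..<max t R} r) * indicator {0<..} r
      \<le> ennreal (M / t) * indicator {t<..<max t R} r"
    proof (cases "t < r")
      case True
      have "r ^ (?n - 1) * (M / r ^ ?n) = M / r" using True t by (cases ?n) simp_all
      also have "\<dots> \<le> M / t" using True t M0 by (intro divide_left_mono) auto
      finally have "r ^ (?n - 1) * (M / r ^ ?n) \<le> M / t" .
      moreover have "ennreal (r ^ (?n - 1)) * ennreal (M / r ^ ?n) = ennreal (r ^ (?n - 1) * (M / r ^ ?n))"
        using True t M0 by (intro ennreal_mult[symmetric]) auto
      ultimately have "ennreal (r ^ (?n - 1)) * ennreal (M / r ^ ?n) \<le> ennreal (M / t)"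
        by (simp only: ennreal_leI)
      then show ?thesis using True t by (auto simp: indicator_def)
    qed simp
  qed auto
  also have "\<dots> < \<infinity>"
    using P by (simp add: nn_integral_cmult_indicator ennreal_mult_less_top)
  finally show "(\<integral>\<^sup>+y. ennreal (norm (indicator {y. norm y > t} y * (P (sgn y) / norm y ^ ?n * u y))) \<partial>lborel) < \<infinity>" .
qed measurable

text \<open>
  Mean zero allows subtracting the radial function \<open>y \<mapsto> g (|y| z)\<close> under the integral; it has bounded
  support since \<open>z \<noteq> 0\<close>. Afterwards absolute values are taken, and polar coordinates apply.
\<close>
lemma truncated_integral_le_oscillation:
  fixes P g :: "'a::euclidean_space \<Rightarrow> real" and t R M :: real
  assumes [measurable]: "P \<in> borel_measurable borel" "g \<in> borel_measurable borel"
    and P: "(\<integral>\<^sup>+\<theta>. ennreal \<bar>P \<theta>\<bar> \<partial>sph) < \<infinity>"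
    and mean: "(\<integral>\<^sup>+\<theta>. ennreal (P \<theta>) \<partial>sph) = (\<integral>\<^sup>+\<theta>. ennreal (- P \<theta>) \<partial>sph)"
    and t: "0 < t" and M: "\<And>y. \<bar>g y\<bar> \<le> M" and R: "\<And>y. R \<le> norm y \<Longrightarrow> g y = 0"
    and z: "z \<noteq> 0"
  shows "ennreal \<bar>LINT y:{y. norm y > t}|lborel. P (sgn y) / norm y ^ DIM('a) * g y\<bar>
    \<le> (\<integral>\<^sup>+\<theta>. ennreal \<bar>P \<theta>\<bar> * (\<integral>\<^sup>+r. ennreal (1 / r) * ennreal \<bar>g (r *\<^sub>R \<theta>) - g (r *\<^sub>R z)\<bar> * indicator {0<..} r \<partial>lborel) \<partial>sph)"
proof -
  let ?n = "DIM('a)"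
  let ?k = "\<lambda>y. indicator {y. norm y > t} y * (P (sgn y) / norm y ^ ?n)"
  have [measurable]: "(\<lambda>y. g (norm y *\<^sub>R z)) \<in> borel_measurable borel" by measurable
  have int1: "integrable lborel (\<lambda>y. ?k y * g y)"
    using integrable_truncated_rough_kernel[OF assms(1,2) P t M R] by (simp add: mult.assoc)
  have zero: "g (norm y *\<^sub>R z) = 0" if "R / norm z \<le> norm y" for y :: 'a
    using that z by (intro R) (simp add: field_simps)
  have int2: "integrable lborel (\<lambda>y. ?k y * g (norm y *\<^sub>R z))"
    using integrable_truncated_rough_kernel[OF assms(1) \<open>(\<lambda>y. g (norm y *\<^sub>R z)) \<in> borel_measurable borel\<close> P t M zero]
    by (simp add: mult.assoc)
  have "(LINT y|lborel. ?k y * g (norm y *\<^sub>R z))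
      = (LINT y|lborel. P (sgn y) * (\<lambda>r. indicator {t<..} r / r ^ ?n * g (r *\<^sub>R z)) (norm y))"
    by (intro Bochner_Integration.integral_cong) (auto simp: indicator_def)
  also have "\<dots> = 0" by (rule integral_mean_zero_times_radial[OF _ _ mean]) measurable
  finally have z0: "(LINT y|lborel. ?k y * g (norm y *\<^sub>R z)) = 0" .
  have "(LINT y:{y. norm y > t}|lborel. P (sgn y) / norm y ^ ?n * g y) = (LINT y|lborel. ?k y * g y)"
    by (simp add: set_lebesgue_integral_def mult_ac)
  also have "\<dots> = (LINT y|lborel. ?k y * g y - ?k y * g (norm y *\<^sub>R z))"
    using int1 int2 z0 by simp
  finally have "ennreal \<bar>LINT y:{y. norm y > t}|lborel. P (sgn y) / norm y ^ ?n * g y\<bar>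
    \<le> (\<integral>\<^sup>+y. ennreal (norm (?k y * g y - ?k y * g (norm y *\<^sub>R z))) \<partial>lborel)"
    using integral_norm_bound_ennreal[OF Bochner_Integration.integrable_diff[OF int1 int2]] by simp
  also have "\<dots> \<le> (\<integral>\<^sup>+y. ennreal \<bar>P (sgn y)\<bar> * ennreal (1 / norm y ^ ?n) * ennreal \<bar>g y - g (norm y *\<^sub>R z)\<bar> \<partial>lborel)"
  proof (rule nn_integral_mono)
    fix y :: 'a
    have "norm (?k y * g y - ?k y * g (norm y *\<^sub>R z)) = \<bar>?k y\<bar> * \<bar>g y - g (norm y *\<^sub>R z)\<bar>"
      by (simp only: right_diff_distrib[symmetric] real_norm_def abs_mult)
    also have "\<dots> \<le> \<bar>P (sgn y)\<bar> * (1 / norm y ^ ?n) * \<bar>g y - g (norm y *\<^sub>R z)\<bar>"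
      by (intro mult_right_mono) (auto simp: indicator_def)
    finally have "norm (?k y * g y - ?k y * g (norm y *\<^sub>R z)) \<le> \<bar>P (sgn y)\<bar> * (1 / norm y ^ ?n) * \<bar>g y - g (norm y *\<^sub>R z)\<bar>" .
    from ennreal_leI[OF this]
    show "ennreal (norm (?k y * g y - ?k y * g (norm y *\<^sub>R z))) \<le> ennreal \<bar>P (sgn y)\<bar> * ennreal (1 / norm y ^ ?n) * ennreal \<bar>g y - g (norm y *\<^sub>R z)\<bar>"
      by (subst (asm) ennreal_mult, simp, simp, subst (asm) ennreal_mult) simp_all
  qed
  also have "\<dots> = (\<integral>\<^sup>+\<theta>. \<integral>\<^sup>+r. ennreal (r ^ (?n - 1)) * (ennreal \<bar>P (sgn (r *\<^sub>R \<theta>))\<bar> * ennreal (1 / norm (r *\<^sub>R \<theta>) ^ ?n) * ennreal \<bar>g (r *\<^sub>R \<theta>) - g (norm (r *\<^sub>R \<theta>) *\<^sub>R z)\<bar>) * indicator {0<..} r \<partial>lborel \<partial>sph)"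
    by (rule polar_coordinates) measurable
  also have "\<dots> = (\<integral>\<^sup>+\<theta>. ennreal \<bar>P \<theta>\<bar> * (\<integral>\<^sup>+r. ennreal (1 / r) * ennreal \<bar>g (r *\<^sub>R \<theta>) - g (r *\<^sub>R z)\<bar> * indicator {0<..} r \<partial>lborel) \<partial>sph)"
  proof (rule nn_integral_cong_AE)
    show "AE \<theta> in sph. (\<integral>\<^sup>+r. ennreal (r ^ (?n - 1)) * (ennreal \<bar>P (sgn (r *\<^sub>R \<theta>))\<bar> * ennreal (1 / norm (r *\<^sub>R \<theta>) ^ ?n) * ennreal \<bar>g (r *\<^sub>R \<theta>) - g (norm (r *\<^sub>R \<theta>) *\<^sub>R z)\<bar>) * indicator {0<..} r \<partial>lborel)
      = ennreal \<bar>P \<theta>\<bar> * (\<integral>\<^sup>+r. ennreal (1 / r) * ennreal \<bar>g (r *\<^sub>R \<theta>) - g (r *\<^sub>R z)\<bar> * indicator {0<..} r \<partial>lborel)"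
      using AE_sph_norm
    proof eventually_elim
      fix \<theta> :: 'a assume \<theta>: "norm \<theta> = 1"
      have "(\<integral>\<^sup>+r. ennreal (r ^ (?n - 1)) * (ennreal \<bar>P (sgn (r *\<^sub>R \<theta>))\<bar> * ennreal (1 / norm (r *\<^sub>R \<theta>) ^ ?n) * ennreal \<bar>g (r *\<^sub>R \<theta>) - g (norm (r *\<^sub>R \<theta>) *\<^sub>R z)\<bar>) * indicator {0<..} r \<partial>lborel)
        = (\<integral>\<^sup>+r. ennreal \<bar>P \<theta>\<bar> * (ennreal (1 / r) * ennreal \<bar>g (r *\<^sub>R \<theta>) - g (r *\<^sub>R z)\<bar> * indicator {0<..} r) \<partial>lborel)"
      proof (rule nn_integral_cong)
        fix r :: real
        show "ennreal (r ^ (?n - 1)) * (ennreal \<bar>P (sgn (r *\<^sub>R \<theta>))\<bar> * ennreal (1 / norm (r *\<^sub>R \<theta>) ^ ?n) * ennreal \<bar>g (r *\<^sub>R \<theta>) - g (norm (r *\<^sub>R \<theta>) *\<^sub>R z)\<bar>) * indicator {0<..} r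
          = ennreal \<bar>P \<theta>\<bar> * (ennreal (1 / r) * ennreal \<bar>g (r *\<^sub>R \<theta>) - g (r *\<^sub>R z)\<bar> * indicator {0<..} r)"
        proof (cases "0 < r")
          case True
          have s: "sgn (r *\<^sub>R \<theta>) = \<theta>" "norm (r *\<^sub>R \<theta>) = r" using True \<theta> by (auto simp: sgn_div_norm)
          have "1 / r = r ^ (?n - 1) * (1 / r ^ ?n)" using True by (cases ?n) simp_all
          then have "ennreal (1 / r) = ennreal (r ^ (?n - 1)) * ennreal (1 / r ^ ?n)"
            using True by (simp only: ennreal_mult[symmetric]) (simp flip: ennreal_mult)
          then show ?thesis unfolding s by (simp add: mult_ac)
        qed simp
      qed
      also have "\<dots> = ennreal \<bar>P \<theta>\<bar> * (\<integral>\<^sup>+r. ennreal (1 / r) * ennreal \<bar>g (r *\<^sub>R \<theta>) - g (r *\<^sub>R z)\<bar> * indicator {0<..} r \<partial>lborel)"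
        by (rule nn_integral_cmult) measurable
      finally show "(\<integral>\<^sup>+r. ennreal (r ^ (?n - 1)) * (ennreal \<bar>P (sgn (r *\<^sub>R \<theta>))\<bar> * ennreal (1 / norm (r *\<^sub>R \<theta>) ^ ?n) * ennreal \<bar>g (r *\<^sub>R \<theta>) - g (norm (r *\<^sub>R \<theta>) *\<^sub>R z)\<bar>) * indicator {0<..} r \<partial>lborel)
      = ennreal \<bar>P \<theta>\<bar> * (\<integral>\<^sup>+r. ennreal (1 / r) * ennreal \<bar>g (r *\<^sub>R \<theta>) - g (r *\<^sub>R z)\<bar> * indicator {0<..} r \<partial>lborel)" .
    qed
  qed
  finally show ?thesis .
qed

lemma weak_bound_imp_integrable:
  fixes P :: "'a::euclidean_space \<Rightarrow> real" and N :: real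
  assumes P [measurable]: "P \<in> borel_measurable borel" and n: "2 \<le> DIM('a)" and N: "0 \<le> N"
    and weak: "\<And>t. t > 0 \<Longrightarrow> t * measure sph {\<theta>. \<bar>P \<theta>\<bar> > t} powr (1 / DIM('a)) \<le> N"
  shows "(\<integral>\<^sup>+\<theta>. ennreal \<bar>P \<theta>\<bar> \<partial>sph) < \<infinity>"
proof -
  have weak': "t * measure sph {\<theta>. \<bar>P \<theta>\<bar> > t} powr (1 / DIM('a)) \<le> N + 1" if "t > 0" for t
    using weak[OF that] by simp
  have "(\<integral>\<^sup>+\<theta>. ennreal \<bar>P \<theta>\<bar> \<partial>sph) = (\<integral>\<^sup>+\<theta>. ennreal (N + 1) * ennreal ((\<bar>P \<theta>\<bar> / (N + 1)) powr 1) \<partial>sph)"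
    using N by (intro nn_integral_cong, subst ennreal_mult[symmetric]) (auto simp del: ennreal_plus)
  also have "\<dots> = ennreal (N + 1) * (\<integral>\<^sup>+\<theta>. ennreal ((\<bar>P \<theta>\<bar> / (N + 1)) powr 1) \<partial>sph)"
    by (rule nn_integral_cmult) measurable
  also have "\<dots> \<le> ennreal (N + 1) * (emeasure (sph :: 'a measure) UNIV + ennreal (2 powr 1 / (1 - 2 powr (1 - real DIM('a)))))"
    using N n by (intro mult_left_mono weak_bound_sph_powr weak') auto
  also have "\<dots> < \<infinity>"
    by (simp add: ennreal_mult_less_top emeasure_sph_UNIV del: ennreal_plus)
  finally show ?thesis .
qed

text \<open>
  The preceding bound holds for every \<open>z \<noteq> 0\<close>, so it may be averaged over \<open>z\<close> in the unit ball. Bounding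
  differences of \<open>g\<close> by integrals along segments, the average over \<open>z\<close> is estimated by
  \<open>subrepresentation_bound\<close> for each radius, the integral over the radii by \<open>dilated_potential_bound\<close>,
  and the remaining integral over the sphere by \<open>cap_potential_bound\<close>. The function \<open>G\<close> stands for the
  length of the gradient of \<open>g\<close> and enters through its integrals along segments.
\<close>
theorem truncated_rough_integral_le_riesz_potential:
  assumes n: "2 \<le> DIM('a::euclidean_space)"
  shows "\<exists>C>0. \<forall>(P :: 'a \<Rightarrow> real) g G N M R t.
    P \<in> borel_measurable borel \<longrightarrow> g \<in> borel_measurable borel \<longrightarrow> G \<in> borel_measurable borel \<longrightarrow>
    0 \<le> N \<longrightarrow> (\<forall>t>0. t * measure sph {\<theta>. \<bar>P \<theta>\<bar> > t} powr (1 / DIM('a)) \<le> N) \<longrightarrow>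
    (\<integral>\<^sup>+\<theta>. ennreal (P \<theta>) \<partial>sph) = (\<integral>\<^sup>+\<theta>. ennreal (- P \<theta>) \<partial>sph) \<longrightarrow>
    (\<forall>y. \<bar>g y\<bar> \<le> M) \<longrightarrow> (\<forall>y. R \<le> norm y \<longrightarrow> g y = 0) \<longrightarrow>
    (\<forall>a b. ennreal \<bar>g a - g b\<bar> \<le> (\<integral>\<^sup>+s. ennreal (norm (b - a)) * G (a + s *\<^sub>R (b - a)) * indicator {0<..<1} s \<partial>lborel)) \<longrightarrow>
    0 < t \<longrightarrow>
    ennreal \<bar>LINT y:{y. norm y > t}|lborel. P (sgn y) / norm y ^ DIM('a) * g y\<bar>
      \<le> ennreal (C * N) * (\<integral>\<^sup>+v. ennreal (1 / norm v ^ (DIM('a) - 1)) * G v \<partial>lborel)"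
proof -
  let ?n = "DIM('a)"
  obtain K where K: "0 < K" and Kbound: "\<And>(P :: 'a \<Rightarrow> real) N \<phi>. P \<in> borel_measurable borel \<Longrightarrow> 0 \<le> N \<Longrightarrow>
    (\<forall>t>0. t * measure sph {\<theta>. \<bar>P \<theta>\<bar> > t} powr (1 / ?n) \<le> N) \<Longrightarrow>
    (\<integral>\<^sup>+\<theta>. ennreal \<bar>P \<theta>\<bar> * cap_kernel \<phi> \<theta> \<partial>sph) \<le> ennreal (K * N)"
    using cap_potential_bound[OF n] by blast
  define w where "w = measure lborel (ball (0::'a) 1)"
  have w: "0 < w" using content_ball_pos[of 1 "0::'a"] by (simp add: w_def)
  have wB: "emeasure lborel (ball (0::'a) 1) = ennreal w"
    using emeasure_lborel_ball_finite[of "0::'a" 1] unfolding w_def by (intro emeasure_eq_ennreal_measure) auto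
  define c1 :: real where "c1 = 2 ^ ?n / ?n"
  define c2 :: real where "c2 = 2 powr cap_exponent ?n * (2 * ?n)"
  have c: "0 < c1" "0 < c2" by (auto simp: c1_def c2_def)
  have main: "ennreal \<bar>LINT y:{y. norm y > t}|lborel. P (sgn y) / norm y ^ ?n * g y\<bar>
      \<le> ennreal (c1 * c2 * K / w * N) * (\<integral>\<^sup>+v. ennreal (1 / norm v ^ (?n - 1)) * G v \<partial>lborel)"
    if [measurable]: "P \<in> borel_measurable borel" "g \<in> borel_measurable borel" "G \<in> borel_measurable borel"
      and N: "0 \<le> N" and weak: "\<forall>t>0. t * measure sph {\<theta>. \<bar>P \<theta>\<bar> > t} powr (1 / ?n) \<le> N"
      and mean: "(\<integral>\<^sup>+\<theta>. ennreal (P \<theta>) \<partial>sph) = (\<integral>\<^sup>+\<theta>. ennreal (- P \<theta>) \<partial>sph)"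
      and M: "\<forall>y. \<bar>g y\<bar> \<le> M" and R: "\<forall>y. R \<le> norm y \<longrightarrow> g y = 0"
      and path: "\<forall>a b. ennreal \<bar>g a - g b\<bar> \<le> (\<integral>\<^sup>+s. ennreal (norm (b - a)) * G (a + s *\<^sub>R (b - a)) * indicator {0<..<1} s \<partial>lborel)"
      and t: "0 < t"
    for P g :: "'a \<Rightarrow> real" and G :: "'a \<Rightarrow> ennreal" and N M R t :: real
  proof -
    define X where "X = ennreal \<bar>LINT y:{y. norm y > t}|lborel. P (sgn y) / norm y ^ ?n * g y\<bar>"
    define I where "I = (\<integral>\<^sup>+v. ennreal (1 / norm v ^ (?n - 1)) * G v \<partial>lborel)"
    define W where "W = (\<lambda>z \<theta>. \<integral>\<^sup>+r. (\<integral>\<^sup>+s. ennreal (norm (z - \<theta>)) * G (r *\<^sub>R (\<theta> + s *\<^sub>R (z - \<theta>))) * indicator {0<..<1::real} s \<partial>lborel) * indicator {0<..} r \<partial>lborel)"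
    have W_meas [measurable]: "(\<lambda>x. W (fst x) (snd x)) \<in> borel_measurable (borel \<Otimes>\<^sub>M borel)"
      unfolding W_def by measurable
    have [measurable]: "(\<lambda>z. W z \<theta>) \<in> borel_measurable borel" for \<theta>
      unfolding W_def by measurable
    have Pint: "(\<integral>\<^sup>+\<theta>. ennreal \<bar>P \<theta>\<bar> \<partial>sph) < \<infinity>"
      using weak by (intro weak_bound_imp_integrable[OF _ n N]) auto
    have step1: "X \<le> (\<integral>\<^sup>+\<theta>. ennreal \<bar>P \<theta>\<bar> * W z \<theta> \<partial>sph)" if z: "z \<noteq> 0" for z
    proof -
      have "X \<le> (\<integral>\<^sup>+\<theta>. ennreal \<bar>P \<theta>\<bar> * (\<integral>\<^sup>+r. ennreal (1 / r) * ennreal \<bar>g (r *\<^sub>R \<theta>) - g (r *\<^sub>R z)\<bar> * indicator {0<..} r \<partial>lborel) \<partial>sph)"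
        unfolding X_def using M R
        by (intro truncated_integral_le_oscillation[OF _ _ Pint mean t _ _ z, of g M R]) auto
      also have "\<dots> \<le> (\<integral>\<^sup>+\<theta>. ennreal \<bar>P \<theta>\<bar> * W z \<theta> \<partial>sph)"
      proof (rule nn_integral_mono, rule mult_left_mono)
        fix \<theta> :: 'a
        show "(\<integral>\<^sup>+r. ennreal (1 / r) * ennreal \<bar>g (r *\<^sub>R \<theta>) - g (r *\<^sub>R z)\<bar> * indicator {0<..} r \<partial>lborel) \<le> W z \<theta>"
          unfolding W_def
        proof (rule nn_integral_mono)
          fix r :: real
          have *: "ennreal (1 / r) * ennreal \<bar>g (r *\<^sub>R \<theta>) - g (r *\<^sub>R z)\<bar> \<le> (\<integral>\<^sup>+s. ennreal (norm (z - \<theta>)) * G (r *\<^sub>R (\<theta> + s *\<^sub>R (z - \<theta>))) * indicator {0<..<1::real} s \<partial>lborel)"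
            if "r \<in> {0<..}"
          proof -
            have r: "0 < r" using that by simp
            have e: "r *\<^sub>R \<theta> + s *\<^sub>R (r *\<^sub>R z - r *\<^sub>R \<theta>) = r *\<^sub>R (\<theta> + s *\<^sub>R (z - \<theta>))" for s
              by (simp add: algebra_simps)
            have m: "norm (r *\<^sub>R z - r *\<^sub>R \<theta>) = r * norm (z - \<theta>)"
              using r by (simp flip: scaleR_diff_right)
            have "ennreal (1 / r) * ennreal \<bar>g (r *\<^sub>R \<theta>) - g (r *\<^sub>R z)\<bar>
              \<le> ennreal (1 / r) * (\<integral>\<^sup>+s. ennreal (r * norm (z - \<theta>)) * G (r *\<^sub>R (\<theta> + s *\<^sub>R (z - \<theta>))) * indicator {0<..<1} s \<partial>lborel)"
              using path[rule_format, of "r *\<^sub>R \<theta>" "r *\<^sub>R z"] unfolding e m by (intro mult_left_mono) auto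
            also have "\<dots> = (\<integral>\<^sup>+s. ennreal (1 / r) * (ennreal (r * norm (z - \<theta>)) * G (r *\<^sub>R (\<theta> + s *\<^sub>R (z - \<theta>))) * indicator {0<..<1} s) \<partial>lborel)"
              by (rule nn_integral_cmult[symmetric]) measurable
            also have "\<dots> = (\<integral>\<^sup>+s. ennreal (norm (z - \<theta>)) * G (r *\<^sub>R (\<theta> + s *\<^sub>R (z - \<theta>))) * indicator {0<..<1} s \<partial>lborel)"
            proof (rule nn_integral_cong)
              fix s :: real
              have "ennreal (1 / r) * ennreal (r * norm (z - \<theta>)) = ennreal (1 / r * (r * norm (z - \<theta>)))"
                using r by (intro ennreal_mult[symmetric]) auto
              also have "1 / r * (r * norm (z - \<theta>)) = norm (z - \<theta>)" using r by simp
              finally show "ennreal (1 / r) * (ennreal (r * norm (z - \<theta>)) * G (r *\<^sub>R (\<theta> + s *\<^sub>R (z - \<theta>))) * indicator {0<..<1} s)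
                = ennreal (norm (z - \<theta>)) * G (r *\<^sub>R (\<theta> + s *\<^sub>R (z - \<theta>))) * indicator {0<..<1} s"
                by (simp flip: mult.assoc)
            qed
            finally show ?thesis .
          qed
          show "ennreal (1 / r) * ennreal \<bar>g (r *\<^sub>R \<theta>) - g (r *\<^sub>R z)\<bar> * indicator {0<..} r
            \<le> (\<integral>\<^sup>+s. ennreal (norm (z - \<theta>)) * G (r *\<^sub>R (\<theta> + s *\<^sub>R (z - \<theta>))) * indicator {0<..<1::real} s \<partial>lborel) * indicator {0<..} r"
            using * by (cases "r \<in> {0<..}") (simp_all del: greaterThan_iff)
        qed
      qed auto
      finally show ?thesis .
    qed
    \<comment> \<open>Average over \<open>z\<close> in the unit ball, whose volume is \<open>w\<close>.\<close>
    have step2: "X * ennreal w \<le> (\<integral>\<^sup>+\<theta>. ennreal \<bar>P \<theta>\<bar> * (\<integral>\<^sup>+z. W z \<theta> * indicator (ball 0 1) z \<partial>lborel) \<partial>sph)"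
    proof -
      have "X * ennreal w = (\<integral>\<^sup>+z. X * indicator (ball (0::'a) 1) z \<partial>lborel)"
        by (simp add: nn_integral_cmult_indicator wB)
      also have "\<dots> \<le> (\<integral>\<^sup>+z. (\<integral>\<^sup>+\<theta>. ennreal \<bar>P \<theta>\<bar> * W z \<theta> * indicator (ball 0 1) z \<partial>sph) \<partial>lborel)"
      proof (rule nn_integral_mono_AE)
        show "AE z in lborel. X * indicator (ball (0::'a) 1) z \<le> (\<integral>\<^sup>+\<theta>. ennreal \<bar>P \<theta>\<bar> * W z \<theta> * indicator (ball 0 1) z \<partial>sph)"
          using AE_lborel_singleton[of "0::'a"]
        proof eventually_elim
          fix z :: 'a assume "z \<noteq> 0"
          then show "X * indicator (ball (0::'a) 1) z \<le> (\<integral>\<^sup>+\<theta>. ennreal \<bar>P \<theta>\<bar> * W z \<theta> * indicator (ball 0 1) z \<partial>sph)"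
            using step1[of z] by (auto simp: indicator_def)
        qed
      qed
      also have "\<dots> = (\<integral>\<^sup>+\<theta>. \<integral>\<^sup>+z. ennreal \<bar>P \<theta>\<bar> * W z \<theta> * indicator (ball 0 1) z \<partial>lborel \<partial>sph)"
        by (rule nn_integral_sph_swap[symmetric]) measurable
      also have "\<dots> = (\<integral>\<^sup>+\<theta>. ennreal \<bar>P \<theta>\<bar> * (\<integral>\<^sup>+z. W z \<theta> * indicator (ball 0 1) z \<partial>lborel) \<partial>sph)"
        unfolding mult.assoc by (rule nn_integral_cong, rule nn_integral_cmult) measurable
      finally show ?thesis .
    qed
    \<comment> \<open>For a fixed direction integrate in \<open>z\<close> first, then in \<open>s\<close>, then in \<open>r\<close>.\<close>
    have step3: "(\<integral>\<^sup>+z. W z \<theta> * indicator (ball 0 1) z \<partial>lborel)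
      \<le> ennreal c1 * (\<integral>\<^sup>+v. ennreal (c2 / norm v ^ (?n - 1)) * G v * cap_kernel (sgn v) \<theta> \<partial>lborel)" if \<theta>: "norm \<theta> = 1" for \<theta>
    proof -
      have "(\<integral>\<^sup>+z. W z \<theta> * indicator (ball 0 1) z \<partial>lborel)
        = (\<integral>\<^sup>+z. \<integral>\<^sup>+r. (\<integral>\<^sup>+s. ennreal (norm (z - \<theta>)) * G (r *\<^sub>R (\<theta> + s *\<^sub>R (z - \<theta>))) * indicator {0<..<1::real} s \<partial>lborel) * indicator {0<..} r * indicator (ball 0 1) z \<partial>lborel \<partial>lborel)"
        unfolding W_def by (rule nn_integral_cong, rule nn_integral_multc[symmetric]) measurable
      also have "\<dots> = (\<integral>\<^sup>+r. \<integral>\<^sup>+z. (\<integral>\<^sup>+s. ennreal (norm (z - \<theta>)) * G (r *\<^sub>R (\<theta> + s *\<^sub>R (z - \<theta>))) * indicator {0<..<1::real} s \<partial>lborel) * indicator {0<..} r * indicator (ball 0 1) z \<partial>lborel \<partial>lborel)"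
        by (rule nn_integral_lborel_swap) measurable
      also have "\<dots> \<le> (\<integral>\<^sup>+r. ennreal c1 * ((\<integral>\<^sup>+u. ennreal (1 / norm (u - \<theta>) ^ (?n - 1)) * G (r *\<^sub>R u) * indicator (ball 0 1) u \<partial>lborel) * indicator {0<..} r) \<partial>lborel)"
      proof (rule nn_integral_mono)
        fix r :: real
        let ?f = "\<lambda>z s. ennreal (norm (z - \<theta>)) * G (r *\<^sub>R (\<theta> + s *\<^sub>R (z - \<theta>)))"
        have "(\<integral>\<^sup>+z. (\<integral>\<^sup>+s. ?f z s * indicator {0<..<1::real} s \<partial>lborel) * indicator (ball 0 1) z \<partial>lborel)
          = (\<integral>\<^sup>+z. \<integral>\<^sup>+s. ?f z s * indicator (ball 0 1) z * indicator {0<..<1::real} s \<partial>lborel \<partial>lborel)"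
        proof (rule nn_integral_cong)
          fix z :: 'a
          show "(\<integral>\<^sup>+s. ?f z s * indicator {0<..<1::real} s \<partial>lborel) * indicator (ball 0 1) z
            = (\<integral>\<^sup>+s. ?f z s * indicator (ball 0 1) z * indicator {0<..<1::real} s \<partial>lborel)"
            by (cases "z \<in> ball 0 1") (simp_all del: mem_ball)
        qed
        also have "\<dots> = (\<integral>\<^sup>+s. \<integral>\<^sup>+z. ?f z s * indicator (ball 0 1) z * indicator {0<..<1::real} s \<partial>lborel \<partial>lborel)"
          by (rule nn_integral_lborel_swap) measurable
        also have "\<dots> = (\<integral>\<^sup>+s. (\<integral>\<^sup>+z. ?f z s * indicator (ball 0 1) z \<partial>lborel) * indicator {0<..<1::real} s \<partial>lborel)"
          by (rule nn_integral_cong, rule nn_integral_multc) measurable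
        also have "\<dots> \<le> (\<integral>\<^sup>+u. ennreal (c1 * (1 / norm (u - \<theta>) ^ (?n - 1))) * G (r *\<^sub>R u) * indicator (ball 0 1) u \<partial>lborel)"
          unfolding c1_def by (rule subrepresentation_bound[of "\<lambda>u. G (r *\<^sub>R u)"]) (use \<theta> in measurable)
        also have "\<dots> = (\<integral>\<^sup>+u. ennreal c1 * (ennreal (1 / norm (u - \<theta>) ^ (?n - 1)) * G (r *\<^sub>R u) * indicator (ball 0 1) u) \<partial>lborel)"
        proof (rule nn_integral_cong)
          fix u :: 'a
          have "ennreal (c1 * (1 / norm (u - \<theta>) ^ (?n - 1))) = ennreal c1 * ennreal (1 / norm (u - \<theta>) ^ (?n - 1))"
            using c by (intro ennreal_mult) auto
          then show "ennreal (c1 * (1 / norm (u - \<theta>) ^ (?n - 1))) * G (r *\<^sub>R u) * indicator (ball 0 1) u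
            = ennreal c1 * (ennreal (1 / norm (u - \<theta>) ^ (?n - 1)) * G (r *\<^sub>R u) * indicator (ball 0 1) u)"
            by (simp add: mult_ac)
        qed
        also have "\<dots> = ennreal c1 * (\<integral>\<^sup>+u. (ennreal (1 / norm (u - \<theta>) ^ (?n - 1)) * G (r *\<^sub>R u) * indicator (ball 0 1) u) \<partial>lborel)"
          by (rule nn_integral_cmult) measurable
        finally have *: "(\<integral>\<^sup>+z. (\<integral>\<^sup>+s. ?f z s * indicator {0<..<1::real} s \<partial>lborel) * indicator (ball 0 1) z \<partial>lborel) \<le> \<dots>" .
        show "(\<integral>\<^sup>+z. (\<integral>\<^sup>+s. ?f z s * indicator {0<..<1::real} s \<partial>lborel) * indicator {0<..} r * indicator (ball 0 1) z \<partial>lborel)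
          \<le> ennreal c1 * ((\<integral>\<^sup>+u. ennreal (1 / norm (u - \<theta>) ^ (?n - 1)) * G (r *\<^sub>R u) * indicator (ball 0 1) u \<partial>lborel) * indicator {0<..} r)"
          using * by (cases "r \<in> {0<..}") (simp_all del: greaterThan_iff)
      qed
      also have "\<dots> = ennreal c1 * (\<integral>\<^sup>+r. ((\<integral>\<^sup>+u. ennreal (1 / norm (u - \<theta>) ^ (?n - 1)) * G (r *\<^sub>R u) * indicator (ball 0 1) u \<partial>lborel) * indicator {0<..} r) \<partial>lborel)"
        by (rule nn_integral_cmult) measurable
      also have "\<dots> \<le> ennreal c1 * (\<integral>\<^sup>+v. ennreal (c2 / norm v ^ (?n - 1)) * G v * cap_kernel (sgn v) \<theta> \<partial>lborel)"
        unfolding c2_def by (intro mult_left_mono dilated_potential_bound n \<theta>) auto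
      finally show ?thesis .
    qed
    have "X * ennreal w \<le> (\<integral>\<^sup>+\<theta>. ennreal \<bar>P \<theta>\<bar> * (ennreal c1 * (\<integral>\<^sup>+v. ennreal (c2 / norm v ^ (?n - 1)) * G v * cap_kernel (sgn v) \<theta> \<partial>lborel)) \<partial>sph)"
    proof (rule order_trans[OF step2], rule nn_integral_mono_AE)
      show "AE \<theta> in sph. ennreal \<bar>P \<theta>\<bar> * (\<integral>\<^sup>+z. W z \<theta> * indicator (ball 0 1) z \<partial>lborel)
        \<le> ennreal \<bar>P \<theta>\<bar> * (ennreal c1 * (\<integral>\<^sup>+v. ennreal (c2 / norm v ^ (?n - 1)) * G v * cap_kernel (sgn v) \<theta> \<partial>lborel))"
        using AE_sph_norm by eventually_elim (intro mult_left_mono step3, auto)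
    qed
    also have "\<dots> = (\<integral>\<^sup>+\<theta>. \<integral>\<^sup>+v. (ennreal c1 * (ennreal (c2 / norm v ^ (?n - 1)) * G v)) * (ennreal \<bar>P \<theta>\<bar> * cap_kernel (sgn v) \<theta>) \<partial>lborel \<partial>sph)"
    proof (rule nn_integral_cong)
      fix \<theta> :: 'a
      have "(\<integral>\<^sup>+v. (ennreal c1 * (ennreal (c2 / norm v ^ (?n - 1)) * G v)) * (ennreal \<bar>P \<theta>\<bar> * cap_kernel (sgn v) \<theta>) \<partial>lborel)
        = (\<integral>\<^sup>+v. (ennreal \<bar>P \<theta>\<bar> * ennreal c1) * (ennreal (c2 / norm v ^ (?n - 1)) * G v * cap_kernel (sgn v) \<theta>) \<partial>lborel)"
        by (intro nn_integral_cong) (simp add: mult_ac)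
      also have "\<dots> = (ennreal \<bar>P \<theta>\<bar> * ennreal c1) * (\<integral>\<^sup>+v. ennreal (c2 / norm v ^ (?n - 1)) * G v * cap_kernel (sgn v) \<theta> \<partial>lborel)"
        by (rule nn_integral_cmult) measurable
      finally show "ennreal \<bar>P \<theta>\<bar> * (ennreal c1 * (\<integral>\<^sup>+v. ennreal (c2 / norm v ^ (?n - 1)) * G v * cap_kernel (sgn v) \<theta> \<partial>lborel))
        = (\<integral>\<^sup>+v. (ennreal c1 * (ennreal (c2 / norm v ^ (?n - 1)) * G v)) * (ennreal \<bar>P \<theta>\<bar> * cap_kernel (sgn v) \<theta>) \<partial>lborel)"
        by (simp add: mult_ac)
    qed
    also have "\<dots> = (\<integral>\<^sup>+v. \<integral>\<^sup>+\<theta>. (ennreal c1 * (ennreal (c2 / norm v ^ (?n - 1)) * G v)) * (ennreal \<bar>P \<theta>\<bar> * cap_kernel (sgn v) \<theta>) \<partial>sph \<partial>lborel)"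
      by (rule nn_integral_sph_swap) measurable
    also have "\<dots> = (\<integral>\<^sup>+v. (ennreal c1 * (ennreal (c2 / norm v ^ (?n - 1)) * G v)) * (\<integral>\<^sup>+\<theta>. ennreal \<bar>P \<theta>\<bar> * cap_kernel (sgn v) \<theta> \<partial>sph) \<partial>lborel)"
      by (rule nn_integral_cong, rule nn_integral_cmult) measurable
    also have "\<dots> \<le> (\<integral>\<^sup>+v. (ennreal c1 * (ennreal (c2 / norm v ^ (?n - 1)) * G v)) * ennreal (K * N) \<partial>lborel)"
      by (rule nn_integral_mono, intro mult_left_mono Kbound N weak) auto
    also have "\<dots> = (\<integral>\<^sup>+v. ennreal (c1 * c2 * K * N) * (ennreal (1 / norm v ^ (?n - 1)) * G v) \<partial>lborel)"
    proof (rule nn_integral_cong)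
      fix v :: 'a
      have "ennreal (c2 / norm v ^ (?n - 1)) = ennreal c2 * ennreal (1 / norm v ^ (?n - 1))"
        using c ennreal_mult[of c2 "1 / norm v ^ (?n - 1)"] by simp
      moreover have "ennreal (c1 * c2 * K * N) = ennreal c1 * ennreal c2 * ennreal (K * N)"
        using c K N by (simp add: ennreal_mult mult_ac)
      ultimately show "(ennreal c1 * (ennreal (c2 / norm v ^ (?n - 1)) * G v)) * ennreal (K * N)
        = ennreal (c1 * c2 * K * N) * (ennreal (1 / norm v ^ (?n - 1)) * G v)" by (simp add: mult_ac)
    qed
    also have "\<dots> = ennreal (c1 * c2 * K * N) * I"
      unfolding I_def by (rule nn_integral_cmult) measurable
    finally have "X * ennreal w * ennreal (1 / w) \<le> ennreal (c1 * c2 * K * N) * I * ennreal (1 / w)"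
      by (intro mult_right_mono) auto
    moreover have "ennreal w * ennreal (1 / w) = 1"
      using w ennreal_mult[of w "1 / w"] by simp
    moreover have "ennreal (c1 * c2 * K * N) * ennreal (1 / w) = ennreal (c1 * c2 * K / w * N)"
      using c K N w ennreal_mult[of "c1 * c2 * K * N" "1 / w"] by simp
    ultimately show ?thesis
      unfolding X_def[symmetric] I_def[symmetric] by (simp add: mult_ac)
  qed
  show ?thesis
  proof (intro exI[of _ "c1 * c2 * K / w"] conjI allI impI)
    show "0 < c1 * c2 * K / w" using c K w by simp
  qed (rule main; assumption)
qed

section \<open>The Riesz potential and the potential operator of a weight\<close>

lemma weight_set_integrable_ball: "weight w \<Longrightarrow> set_integrable lebesgue (ball a r) w"
  by (rule set_integrable_subset[of _ "cball a r"]) (auto simp: weight_def)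

lemma weight_mass_nn_integral:
  assumes "weight w"
  shows "(\<integral>\<^sup>+x. ennreal (w x) * indicator (ball a r) x \<partial>lebesgue) = ennreal (weight_mass w (ball a r))"
proof -
  have "(\<integral>\<^sup>+x. ennreal (w x) * indicator (ball a r) x \<partial>lebesgue)
      = (\<integral>\<^sup>+x. ennreal (indicator (ball a r) x *\<^sub>R w x) \<partial>lebesgue)"
    by (intro nn_integral_cong) (auto simp: indicator_def)
  also have "\<dots> = ennreal (weight_mass w (ball a r))"
    unfolding weight_mass_def set_lebesgue_integral_def
    using weight_set_integrable_ball[OF assms, of a r] assms unfolding set_integrable_def
    by (intro nn_integral_eq_integral) (auto simp: weight_def)
  finally show ?thesis .
qed

lemma weight_mass_nonneg: "weight w \<Longrightarrow> 0 \<le> weight_mass w (ball a r)"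
  unfolding weight_mass_def set_lebesgue_integral_def
  by (intro integral_nonneg_AE) (auto simp: weight_def)

lemma weight_mass_mono:
  assumes "weight w" "ball a r \<subseteq> ball b s"
  shows "weight_mass w (ball a r) \<le> weight_mass w (ball b s)"
proof -
  have "ennreal (weight_mass w (ball a r)) \<le> ennreal (weight_mass w (ball b s))"
    unfolding weight_mass_nn_integral[OF assms(1), symmetric]
    using assms(2) by (intro nn_integral_mono mult_left_mono) (auto simp: indicator_def)
  then show ?thesis using weight_mass_nonneg[OF assms(1)] by simp
qed

lemma weight_mass_zero_AE:
  assumes w: "weight w" and z: "weight_mass w (ball a r) = 0"
  shows "AE x in lebesgue. x \<in> ball a r \<longrightarrow> w x = 0"
proof -
  have m: "w \<in> borel_measurable lebesgue" and nn: "\<And>x. 0 \<le> w x" using w by (auto simp: weight_def)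
  have "(\<integral>\<^sup>+x. ennreal (w x) * indicator (ball a r) x \<partial>lebesgue) = 0"
    using weight_mass_nn_integral[OF w, of a r] z by simp
  then have "AE x in lebesgue. ennreal (w x) * indicator (ball a r) x = 0"
    using m by (subst (asm) nn_integral_0_iff_AE)
      (auto intro!: borel_measurable_times_ennreal borel_measurable_indicator)
  then show ?thesis
  proof eventually_elim
    fix x assume "ennreal (w x) * indicator (ball a r) x = 0"
    then show "x \<in> ball a r \<longrightarrow> w x = 0" using nn[of x] by (auto simp: ennreal_eq_0_iff)
  qed
qed

lemma not_AE_notin_ball: "0 < r \<Longrightarrow> \<not> (AE x in lebesgue. x \<notin> ball (a::'a::euclidean_space) r)"
proof
  assume r: "0 < r" and "AE x in lebesgue. x \<notin> ball a r"
  then have "ball a r \<in> null_sets lebesgue"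
    by (subst (asm) AE_iff_null_sets[symmetric]) auto
  then have "measure lebesgue (ball a r) = 0" by (auto simp: measure_def)
  with content_ball_pos[OF r, of a] show False by simp
qed

lemma weight_mass_ball_pos_ex:
  assumes w: "weight (w :: 'a::euclidean_space \<Rightarrow> real)"
  shows "\<exists>k::nat. 0 < weight_mass w (ball 0 (real k))"
proof (rule ccontr)
  assume "\<not> ?thesis"
  then have "weight_mass w (ball 0 (real k)) = 0" for k :: nat
    using weight_mass_nonneg[OF w, of 0 "real k"] by (meson leD le_less_linear order_antisym)
  then have "AE x in lebesgue. x \<in> ball 0 (real k) \<longrightarrow> w x = 0" for k :: nat
    by (rule weight_mass_zero_AE[OF w])
  then have "AE x in lebesgue. \<forall>k::nat. x \<in> ball 0 (real k) \<longrightarrow> w x = 0"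
    unfolding AE_all_countable by blast
  then have "AE x in lebesgue. w x = 0"
  proof eventually_elim
    fix x assume *: "\<forall>k::nat. x \<in> ball 0 (real k) \<longrightarrow> w x = 0"
    obtain k :: nat where "norm x < real k" using reals_Archimedean2 by blast
    with * show "w x = 0" by auto
  qed
  with w show False by (simp add: weight_def)
qed

text \<open>
  On a ball of positive mass the mean of \<open>w\<close> is a positive lower bound for \<open>C w\<close>.
\<close>
lemma A1_bound_pos:
  assumes w: "weight (w :: 'a::euclidean_space \<Rightarrow> real)" and C: "A1_bound w C"
    and m: "0 < weight_mass w (ball a r)"
  shows "0 < C" "AE x in lebesgue. x \<in> ball a r \<longrightarrow> 0 < w x"
proof -
  have r: "0 < r"
  proof (rule ccontr)
    assume "\<not> 0 < r"
    then have "ball a r = {}" by auto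
    with m show False by (simp add: weight_mass_def set_lebesgue_integral_def)
  qed
  have ae: "AE x in lebesgue. x \<in> ball a r \<longrightarrow> weight_mass w (ball a r) / measure lebesgue (ball a r) \<le> C * w x"
    using C r by (auto simp: A1_bound_def)
  have q: "0 < weight_mass w (ball a r) / measure lebesgue (ball a r)"
    using m content_ball_pos[OF r, of a] by simp
  have nn: "\<And>x. 0 \<le> w x" using w by (auto simp: weight_def)
  show "0 < C"
  proof (rule ccontr)
    assume "\<not> 0 < C"
    then have "C * w x \<le> 0" for x using nn[of x] by (simp add: mult_nonpos_nonneg)
    then have neg: "\<not> weight_mass w (ball a r) / measure lebesgue (ball a r) \<le> C * w x" for x
      using q by (meson le_less_trans not_le order_less_irrefl)
    from ae have "AE x in lebesgue. x \<notin> ball a r"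
      by eventually_elim (use neg in blast)
    with not_AE_notin_ball[OF r] show False by blast
  qed
  show "AE x in lebesgue. x \<in> ball a r \<longrightarrow> 0 < w x"
    using ae
  proof eventually_elim
    fix x assume *: "x \<in> ball a r \<longrightarrow> weight_mass w (ball a r) / measure lebesgue (ball a r) \<le> C * w x"
    show "x \<in> ball a r \<longrightarrow> 0 < w x"
    proof
      assume "x \<in> ball a r"
      with * q have "0 < C * w x" by linarith
      then show "0 < w x" using nn[of x] by (cases "w x = 0") auto
    qed
  qed
qed

text \<open>
  Some large ball contains the given one and a ball of positive mass, so \<open>w\<close> is positive almost everywhere in it.
\<close>
lemma A1_mass_pos:
  assumes w: "weight (w :: 'a::euclidean_space \<Rightarrow> real)" and C: "A1_bound w C" and r: "0 < r"
  shows "0 < weight_mass w (ball a r)"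
proof (rule ccontr)
  assume "\<not> 0 < weight_mass w (ball a r)"
  then have "weight_mass w (ball a r) = 0" using weight_mass_nonneg[OF w, of a r] by simp
  then have z: "AE x in lebesgue. x \<in> ball a r \<longrightarrow> w x = 0" by (rule weight_mass_zero_AE[OF w])
  obtain k :: nat where k: "0 < weight_mass w (ball 0 (real k))" using weight_mass_ball_pos_ex[OF w] by blast
  define R where "R = r + norm a + real k"
  have "ball 0 (real k) \<subseteq> ball a R"
  proof
    fix y :: 'a assume "y \<in> ball 0 (real k)"
    then have "norm y < k" by simp
    then have "norm (a - y) < R" using norm_triangle_ineq4[of a y] r by (simp add: R_def)
    then show "y \<in> ball a R" by (simp add: dist_norm)
  qed
  with weight_mass_mono[OF w] k have "0 < weight_mass w (ball a R)" by (meson less_le_trans)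
  from A1_bound_pos(2)[OF w C this] z have "AE x in lebesgue. x \<notin> ball a r"
  proof eventually_elim
    fix x assume "x \<in> ball a R \<longrightarrow> 0 < w x" "x \<in> ball a r \<longrightarrow> w x = 0"
    moreover have "r \<le> R" by (simp add: R_def)
    ultimately show "x \<notin> ball a r" by auto
  qed
  with not_AE_notin_ball[OF r] show False by blast
qed

text \<open>
  Each ball admits the constants \<open>A1_const w + 1 / (j + 1)\<close>; the countably many exceptional null sets are
  discarded together before the limit is taken.
\<close>
lemma A1_const_attained:
  assumes w: "(w :: 'a::euclidean_space \<Rightarrow> real) \<in> A1_weights"
  shows "0 < A1_const w" "A1_bound w (A1_const w)"
proof -
  have wt: "weight w" and ne: "{C. A1_bound w C} \<noteq> {}" using w by (auto simp: A1_weights_def)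
  have nn: "\<And>x. 0 \<le> w x" using wt by (auto simp: weight_def)
  obtain k :: nat where k: "0 < weight_mass w (ball 0 (real k))" using weight_mass_ball_pos_ex[OF wt] by blast
  have step: "A1_bound w (A1_const w + 1 / Suc j)" for j
  proof -
    have "Inf {C. A1_bound w C} < A1_const w + 1 / Suc j" by (simp add: A1_const_def)
    from cInf_lessD[OF ne this] obtain C where C: "A1_bound w C" "C < A1_const w + 1 / Suc j" by blast
    have "C * w x \<le> (A1_const w + 1 / Suc j) * w x" for x
      using C nn by (intro mult_right_mono) auto
    then have le: "C * w x \<le> (A1_const w + 1 / Suc j) * w x" for x .
    show ?thesis unfolding A1_bound_def
    proof (intro allI impI)
      fix a :: 'a and r :: real assume "0 < r"
      then have "AE x in lebesgue. x \<in> ball a r \<longrightarrow> weight_mass w (ball a r) / measure lebesgue (ball a r) \<le> C * w x"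
        using C(1) by (simp add: A1_bound_def)
      then show "AE x in lebesgue. x \<in> ball a r \<longrightarrow> weight_mass w (ball a r) / measure lebesgue (ball a r) \<le> (A1_const w + 1 / Suc j) * w x"
        by eventually_elim (use le order_trans in blast)
    qed
  qed
  show A: "A1_bound w (A1_const w)"
    unfolding A1_bound_def
  proof (intro allI impI)
    fix a :: 'a and r :: real assume r: "0 < r"
    have "AE x in lebesgue. \<forall>j. x \<in> ball a r \<longrightarrow> weight_mass w (ball a r) / measure lebesgue (ball a r) \<le> (A1_const w + 1 / Suc j) * w x"
      using step r unfolding A1_bound_def AE_all_countable by blast
    then show "AE x in lebesgue. x \<in> ball a r \<longrightarrow> weight_mass w (ball a r) / measure lebesgue (ball a r) \<le> A1_const w * w x"
    proof eventually_elim
      fix x assume *: "\<forall>j. x \<in> ball a r \<longrightarrow> weight_mass w (ball a r) / measure lebesgue (ball a r) \<le> (A1_const w + 1 / Suc j) * w x"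
      have "(\<lambda>j. (A1_const w + 1 / Suc j) * w x) \<longlonglongrightarrow> (A1_const w + 0) * w x"
        by (intro tendsto_mult tendsto_add tendsto_const LIMSEQ_Suc[OF lim_1_over_n])
      then show "x \<in> ball a r \<longrightarrow> weight_mass w (ball a r) / measure lebesgue (ball a r) \<le> A1_const w * w x"
        using * by (auto intro!: LIMSEQ_le_const)
    qed
  qed
  show "0 < A1_const w" by (rule A1_bound_pos(1)[OF wt A k])
qed

text \<open>
  The point \<open>y\<close> lies on the boundary of the ball occurring in the potential operator, and the exceptional null set of the
  \<open>A\<^sub>1\<close> condition depends on the ball. Enlarging the radius to the next power of two settles both: only
  countably many balls around \<open>x\<close> are used, and the volume grows by a factor of at most \<open>2\<^sup>n\<close>.
\<close>
lemma riesz_kernel_le_A1_kernel: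
  assumes w: "(w :: 'a::euclidean_space \<Rightarrow> real) \<in> A1_weights"
  shows "AE y in lebesgue. 1 / norm (x - y) ^ (DIM('a) - 1)
    \<le> measure lborel (ball (0::'a) 1) * 2 ^ DIM('a) * A1_const w
        * (norm (x - y) / weight_mass w (ball x (norm (x - y))) * w y)"
proof -
  let ?n = "DIM('a)" and ?v = "measure lborel (ball (0::'a) 1)" and ?A = "A1_const w"
  have wt: "weight w" using w by (auto simp: A1_weights_def)
  have nn: "\<And>x. 0 \<le> w x" using wt by (auto simp: weight_def)
  note A = A1_const_attained[OF w]
  have "AE y in lebesgue. y \<in> ball x (2 powr real_of_int k) \<longrightarrow> weight_mass w (ball x (2 powr k)) / measure lebesgue (ball x (2 powr k)) \<le> ?A * w y" for k :: int
    using A(2) unfolding A1_bound_def by auto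
  then have "AE y in lebesgue. \<forall>k::int. y \<in> ball x (2 powr real_of_int k) \<longrightarrow> weight_mass w (ball x (2 powr k)) / measure lebesgue (ball x (2 powr k)) \<le> ?A * w y"
    by (simp add: AE_all_countable)
  moreover have "AE y in lebesgue. y \<noteq> x"
    using AE_lborel_singleton[of x] by (rule AE_completion)
  ultimately show ?thesis
  proof eventually_elim
    fix y
    assume *: "\<forall>k::int. y \<in> ball x (2 powr real_of_int k) \<longrightarrow> weight_mass w (ball x (2 powr k)) / measure lebesgue (ball x (2 powr k)) \<le> ?A * w y"
      and ne: "y \<noteq> x"
    define d where "d = norm (x - y)"
    have d: "0 < d" using ne by (simp add: d_def)
    \<comment> \<open>The power of two with \<open>d < 2\<^sup>k \<le> 2 d\<close>.\<close>
    define k where "k = \<lfloor>log 2 d\<rfloor> + 1"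
    define \<rho> where "\<rho> = 2 powr real_of_int k"
    have "log 2 d < k" unfolding k_def by simp
    then have "2 powr (log 2 d) < \<rho>" unfolding \<rho>_def by (intro powr_less_mono) auto
    then have d1: "d < \<rho>" using d by simp
    have "k \<le> log 2 d + 1" unfolding k_def by simp
    then have "\<rho> \<le> 2 powr (log 2 d + 1)" unfolding \<rho>_def by (intro powr_mono) auto
    also have "\<dots> = 2 * d" using d by (simp add: powr_add)
    finally have d2: "\<rho> \<le> 2 * d" .
    have \<rho>0: "0 < \<rho>" by (simp add: \<rho>_def)
    have "y \<in> ball x \<rho>" using d1 by (simp add: d_def dist_norm)
    with * have "weight_mass w (ball x \<rho>) / measure lebesgue (ball x \<rho>) \<le> ?A * w y"
      unfolding \<rho>_def by blast
    moreover have m: "measure lebesgue (ball x \<rho>) = \<rho> ^ ?n * ?v"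
      using content_ball_conv_unit_ball[of \<rho> x] \<rho>0 by simp
    moreover have "0 < measure lebesgue (ball x \<rho>)"
      using content_ball_pos[OF \<rho>0, of x] by simp
    ultimately have "weight_mass w (ball x \<rho>) \<le> \<rho> ^ ?n * ?v * (?A * w y)"
      by (simp add: pos_divide_le_eq mult.commute)
    also have "\<dots> \<le> (2 * d) ^ ?n * ?v * (?A * w y)"
      using d2 \<rho>0 A(1) nn[of y] by (intro mult_right_mono power_mono) auto
    finally have "weight_mass w (ball x d) \<le> (2 * d) ^ ?n * ?v * (?A * w y)"
      using weight_mass_mono[OF wt, of x d x \<rho>] d1 by (meson less_imp_le order_trans subset_ball)
    moreover have p: "0 < weight_mass w (ball x d)" by (rule A1_mass_pos[OF wt A(2) d])
    ultimately have "1 \<le> (2 * d) ^ ?n * ?v * (?A * w y) / weight_mass w (ball x d)" by simp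
    then have "1 / d ^ (?n - 1) * 1 \<le> 1 / d ^ (?n - 1) * ((2 * d) ^ ?n * ?v * (?A * w y) / weight_mass w (ball x d))"
      using d by (intro mult_left_mono) auto
    also have "\<dots> = ((2 * d) ^ ?n / d ^ (?n - 1)) * (?v * (?A * w y) / weight_mass w (ball x d))"
      by simp
    also have "(2 * d) ^ ?n / d ^ (?n - 1) = 2 ^ ?n * d"
      using d by (cases ?n) (simp_all add: power_mult_distrib)
    finally show "1 / norm (x - y) ^ (?n - 1) \<le> ?v * 2 ^ ?n * ?A * (norm (x - y) / weight_mass w (ball x (norm (x - y))) * w y)"
      by (simp add: d_def[symmetric] mult_ac)
  qed
qed

text \<open>
  The kernel of the potential operator is measurable because the mass of a ball is monotone in its radius.
\<close>
lemma riesz_potential_le_potential_op: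
  fixes w u :: "'a::euclidean_space \<Rightarrow> real"
  assumes w: "w \<in> A1_weights" and u: "u \<in> borel_measurable borel" "\<And>y. 0 \<le> u y"
  shows "(\<integral>\<^sup>+y. ennreal (1 / norm (x - y) ^ (DIM('a) - 1)) * ennreal (u y) \<partial>lborel)
    \<le> ennreal (measure lborel (ball (0::'a) 1) * 2 ^ DIM('a) * A1_const w) * potential_op w u x"
proof -
  let ?c = "measure lborel (ball (0::'a) 1) * 2 ^ DIM('a) * A1_const w"
  have wt: "weight w" using w by (auto simp: A1_weights_def)
  have c: "0 \<le> ?c" using A1_const_attained(1)[OF w] by simp
  have [measurable]: "w \<in> borel_measurable lebesgue" "u \<in> borel_measurable lebesgue"
    using wt u by (auto simp: weight_def intro: measurable_completion)
  have "mono (\<lambda>r. weight_mass w (ball x r))"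
    by (intro monoI weight_mass_mono[OF wt] subset_ball)
  then have [measurable]: "(\<lambda>r. weight_mass w (ball x r)) \<in> borel_measurable borel"
    by (rule borel_measurable_mono)
  have [measurable]: "(\<lambda>y. norm (x - y) / weight_mass w (ball x (norm (x - y)))) \<in> borel_measurable lebesgue"
    by (rule measurable_completion) measurable
  have "(\<integral>\<^sup>+y. ennreal (1 / norm (x - y) ^ (DIM('a) - 1)) * ennreal (u y) \<partial>lborel)
    = (\<integral>\<^sup>+y. ennreal (1 / norm (x - y) ^ (DIM('a) - 1)) * ennreal (u y) \<partial>lebesgue)"
    by (rule nn_integral_completion[symmetric])
  also have "\<dots> \<le> (\<integral>\<^sup>+y. ennreal ?c * ennreal (norm (x - y) / weight_mass w (ball x (norm (x - y))) * u y * w y) \<partial>lebesgue)"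
  proof (rule nn_integral_mono_AE)
    show "AE y in lebesgue. ennreal (1 / norm (x - y) ^ (DIM('a) - 1)) * ennreal (u y)
      \<le> ennreal ?c * ennreal (norm (x - y) / weight_mass w (ball x (norm (x - y))) * u y * w y)"
      using riesz_kernel_le_A1_kernel[OF w, of x]
    proof eventually_elim
      fix y
      assume "1 / norm (x - y) ^ (DIM('a) - 1) \<le> ?c * (norm (x - y) / weight_mass w (ball x (norm (x - y))) * w y)"
      then have "1 / norm (x - y) ^ (DIM('a) - 1) * u y \<le> ?c * (norm (x - y) / weight_mass w (ball x (norm (x - y))) * w y) * u y"
        using u(2)[of y] by (rule mult_right_mono)
      also have "\<dots> = ?c * (norm (x - y) / weight_mass w (ball x (norm (x - y))) * u y * w y)"
        by (simp add: mult_ac)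
      finally have "ennreal (1 / norm (x - y) ^ (DIM('a) - 1) * u y) \<le> ennreal (?c * (norm (x - y) / weight_mass w (ball x (norm (x - y))) * u y * w y))"
        by (rule ennreal_leI)
      moreover have "ennreal (1 / norm (x - y) ^ (DIM('a) - 1) * u y) = ennreal (1 / norm (x - y) ^ (DIM('a) - 1)) * ennreal (u y)"
        using u by (intro ennreal_mult) auto
      moreover have "0 \<le> norm (x - y) / weight_mass w (ball x (norm (x - y))) * u y * w y"
        using u(2) wt weight_mass_nonneg[OF wt] by (auto simp: weight_def)
      then have "ennreal (?c * (norm (x - y) / weight_mass w (ball x (norm (x - y))) * u y * w y))
        = ennreal ?c * ennreal (norm (x - y) / weight_mass w (ball x (norm (x - y))) * u y * w y)"
        using c by (intro ennreal_mult)
      ultimately show "ennreal (1 / norm (x - y) ^ (DIM('a) - 1)) * ennreal (u y)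
        \<le> ennreal ?c * ennreal (norm (x - y) / weight_mass w (ball x (norm (x - y))) * u y * w y)" by simp
    qed
  qed
  also have "\<dots> = ennreal ?c * potential_op w u x"
    unfolding potential_op_def by (rule nn_integral_cmult) measurable
  finally show ?thesis .
qed

section \<open>Smooth functions along segments\<close>

lemma frechet_derivative_le_gradient:
  fixes f :: "'a::euclidean_space \<Rightarrow> real"
  assumes "f differentiable at x"
  shows "\<bar>frechet_derivative f (at x) h\<bar> \<le> norm (gradient f x) * norm h"
proof -
  interpret linear "frechet_derivative f (at x)" by (rule linear_frechet_derivative[OF assms])
  have "frechet_derivative f (at x) h = frechet_derivative f (at x) (\<Sum>i\<in>Basis. (h \<bullet> i) *\<^sub>R i)"
    by (simp add: euclidean_representation)
  also have "\<dots> = gradient f x \<bullet> h"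
    by (simp add: sum scale gradient_def inner_sum_left)
      (simp add: inner_commute[of h] mult.commute)
  finally show ?thesis by (simp add: Cauchy_Schwarz_ineq2)
qed

lemma smooth_differentiable: "smooth f \<Longrightarrow> f differentiable at x"
  unfolding smooth_def by (metis Ck.simps(2))

lemma smooth_continuous_gradient:
  assumes "smooth (f :: 'a::euclidean_space \<Rightarrow> real)"
  shows "continuous_on UNIV (gradient f)"
proof -
  have "Ck (Suc 0) f" using assms by (auto simp: smooth_def)
  then have "continuous_on UNIV (\<lambda>x. frechet_derivative f (at x) i)" if "i \<in> Basis" for i
    using that by simp
  then show ?thesis unfolding gradient_def by (intro continuous_intros) auto
qed

text \<open>
  The fundamental theorem of calculus on the segment. The bound \<open>|\<nabla> f| |b - a|\<close> is continuous along it,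
  so its gauge integral is also a Lebesgue integral.
\<close>
lemma difference_le_line_integral_gradient:
  fixes f :: "'a::euclidean_space \<Rightarrow> real"
  assumes f: "smooth f"
  shows "ennreal \<bar>f a - f b\<bar>
    \<le> (\<integral>\<^sup>+s. ennreal (norm (b - a)) * ennreal (norm (gradient f (a + s *\<^sub>R (b - a)))) * indicator {0<..<1} s \<partial>lborel)"
proof -
  define \<phi>' where "\<phi>' = (\<lambda>s::real. frechet_derivative f (at (a + s *\<^sub>R (b - a))) (b - a))"
  define B where "B = (\<lambda>s::real. norm (b - a) * norm (gradient f (a + s *\<^sub>R (b - a))))"
  have "continuous_on UNIV B"
    unfolding B_def
    by (intro continuous_intros continuous_on_compose2[OF smooth_continuous_gradient[OF f]]) auto
  then have B: "continuous_on {0..1} B" and [measurable]: "B \<in> borel_measurable borel"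
    by (auto intro: continuous_on_subset borel_measurable_continuous_onI)
  have B0: "0 \<le> B s" for s by (simp add: B_def)
  have "((\<lambda>s. f (a + s *\<^sub>R (b - a))) has_vector_derivative \<phi>' s) (at s within {0..1})" for s
  proof -
    have "(f has_derivative frechet_derivative f (at (a + s *\<^sub>R (b - a)))) (at (a + s *\<^sub>R (b - a)))"
      using smooth_differentiable[OF f] by (simp add: frechet_derivative_works)
    moreover have "((\<lambda>s. a + s *\<^sub>R (b - a)) has_derivative (\<lambda>h. h *\<^sub>R (b - a))) (at s within {0..1})"
      by (auto intro!: derivative_eq_intros)
    ultimately have "((\<lambda>s. f (a + s *\<^sub>R (b - a))) has_derivative (\<lambda>h. frechet_derivative f (at (a + s *\<^sub>R (b - a))) (h *\<^sub>R (b - a)))) (at s within {0..1})"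
      by (rule has_derivative_compose[rotated])
    moreover have "linear (frechet_derivative f (at (a + s *\<^sub>R (b - a))))"
      by (rule linear_frechet_derivative[OF smooth_differentiable[OF f]])
    ultimately show ?thesis
      by (simp add: has_vector_derivative_def \<phi>'_def linear_scale)
  qed
  then have FTC: "(\<phi>' has_integral (f (a + 1 *\<^sub>R (b - a)) - f (a + 0 *\<^sub>R (b - a)))) {0..1}"
    by (intro fundamental_theorem_of_calculus) auto
  have "norm (integral {0..1} \<phi>') \<le> integral {0..1} B"
  proof (rule integral_norm_bound_integral)
    show "\<phi>' integrable_on {0..1}" using FTC by (rule has_integral_integrable)
    show "B integrable_on {0..1}" using B by (rule integrable_continuous_interval)
    show "norm (\<phi>' s) \<le> B s" for s
      using frechet_derivative_le_gradient[OF smooth_differentiable[OF f]]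
      by (simp add: \<phi>'_def B_def mult.commute)
  qed
  then have "\<bar>f a - f b\<bar> \<le> integral {0..1} B"
    using FTC by (simp add: integral_unique abs_minus_commute)
  then have "ennreal \<bar>f a - f b\<bar> \<le> ennreal (integral {0..1} B)" by (rule ennreal_leI)
  also have "\<dots> = (\<integral>\<^sup>+s. ennreal (if s \<in> {0..1} then B s else 0) \<partial>lborel)"
  proof (rule nn_integral_has_integral_lborel[symmetric])
    show "((\<lambda>s. if s \<in> {0..1} then B s else 0) has_integral integral {0..1} B) UNIV"
      using integrable_integral[OF integrable_continuous_interval[OF B]]
      by (simp only: has_integral_restrict_UNIV)
  qed (use B0 in auto)
  also have "\<dots> = (\<integral>\<^sup>+s. ennreal (norm (b - a)) * ennreal (norm (gradient f (a + s *\<^sub>R (b - a)))) * indicator {0<..<1} s \<partial>lborel)"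
  proof (rule nn_integral_cong_AE)
    show "AE s in lborel. ennreal (if s \<in> {0..1} then B s else 0)
      = ennreal (norm (b - a)) * ennreal (norm (gradient f (a + s *\<^sub>R (b - a)))) * indicator {0<..<1} s"
      using AE_lborel_singleton[of "0::real"] AE_lborel_singleton[of "1::real"]
      by eventually_elim (auto simp: B_def ennreal_mult indicator_def)
  qed
  finally show ?thesis .
qed

section \<open>From the completed surface measure to Borel functions\<close>

text \<open>
  The kernel is measurable only with respect to the completed measure on the sphere. A Borel function \<open>P\<close>
  agrees with it almost everywhere on the sphere, hence, by homogeneity and polar coordinates,
  \<open>P (sgn y)\<close> agrees with it almost everywhere in the space. All hypotheses pass to \<open>P\<close>.
\<close>
lemma sphere_representative:
  fixes \<Omega> :: "'a::euclidean_space \<Rightarrow> real"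
  assumes hom: "homogeneous_degree_zero \<Omega>" and n: "2 \<le> DIM('a)"
    and mean: "(\<integral>\<theta>. \<Omega> \<theta> \<partial>sphere_measure) = 0"
    and weak: "\<Omega> \<in> weak_Lp sphere_measure (real DIM('a))"
  obtains P N where "P \<in> borel_measurable borel" "0 \<le> N"
    "weak_Lp_norm sphere_measure (real DIM('a)) \<Omega> = ennreal N"
    "\<forall>t>0. t * measure sph {\<theta>. \<bar>P \<theta>\<bar> > t} powr (1 / DIM('a)) \<le> N"
    "(\<integral>\<^sup>+\<theta>. ennreal (P \<theta>) \<partial>sph) = (\<integral>\<^sup>+\<theta>. ennreal (- P \<theta>) \<partial>sph)"
    "AE y in lebesgue. \<Omega> y = P (sgn y)"
proof -
  define \<nu> :: "'a measure" where "\<nu> = distr (scale_measure (of_nat DIM('a)) (restrict_space lborel (ball 0 1 - {0})))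
              (restrict_space borel (sphere 0 1)) (\<lambda>x. x /\<^sub>R norm x)"
  have sm: "(sphere_measure :: 'a measure) = completion \<nu>" by (simp add: sphere_measure_def \<nu>_def)
  have sph: "sph = distr \<nu> borel (\<lambda>x. x)" by (simp add: sph_def \<nu>_def)
  have sets_\<nu>: "sets \<nu> = sets (restrict_space borel (sphere 0 1))"
    and space_\<nu>: "space \<nu> = sphere 0 1" by (simp_all add: \<nu>_def space_restrict_space)
  have id: "(\<lambda>x. x) \<in> \<nu> \<rightarrow>\<^sub>M borel"
    by (simp cong: measurable_cong_sets[OF sets_\<nu> refl] add: measurable_restrict_space1)
  have "\<Omega> \<in> borel_measurable (completion \<nu>)" and fin: "weak_Lp_norm sphere_measure (real DIM('a)) \<Omega> < \<infinity>"
    using weak by (auto simp: weak_Lp_def sm)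
  then obtain \<Omega>' where \<Omega>': "\<Omega>' \<in> borel_measurable \<nu>" "AE \<theta> in \<nu>. \<Omega> \<theta> = \<Omega>' \<theta>"
    using completion_ex_borel_measurable_real by blast
  define P where "P = (\<lambda>\<theta>. indicator (sphere 0 1) \<theta> *\<^sub>R \<Omega>' \<theta>)"
  have P [measurable]: "P \<in> borel_measurable borel"
    unfolding P_def using \<Omega>'(1)
    by (subst borel_measurable_restrict_space_iff[symmetric]) (auto cong: measurable_cong_sets[OF sets_\<nu> refl])
  have P\<nu> [measurable]: "P \<in> borel_measurable \<nu>" using measurable_compose[OF id P] by simp
  have ae: "AE \<theta> in \<nu>. \<Omega> \<theta> = P \<theta>"
    using \<Omega>'(2) AE_space by eventually_elim (simp add: P_def space_\<nu>)
  define N where "N = enn2real (weak_Lp_norm sphere_measure (real DIM('a)) \<Omega>)"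
  have N: "weak_Lp_norm sphere_measure (real DIM('a)) \<Omega> = ennreal N"
    using fin by (simp add: N_def)
  have Nweak: "t * measure sph {\<theta>. \<bar>P \<theta>\<bar> > t} powr (1 / DIM('a)) \<le> N" if t: "0 < t" for t
  proof -
    have s: "{\<theta> \<in> space \<nu>. t < \<bar>P \<theta>\<bar>} \<in> sets \<nu>" by measurable
    have [measurable]: "\<Omega> \<in> borel_measurable (completion \<nu>)" by fact
    have s2: "{\<theta> \<in> space (completion \<nu>). t < \<bar>\<Omega> \<theta>\<bar>} \<in> sets (completion \<nu>)" by measurable
    have "measure sph {\<theta>. \<bar>P \<theta>\<bar> > t} = measure \<nu> {\<theta> \<in> space \<nu>. t < \<bar>P \<theta>\<bar>}"
      unfolding sph by (subst measure_distr[OF id]) (auto intro!: arg_cong[where f="measure \<nu>"])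
    also have "\<dots> = measure (completion \<nu>) {\<theta> \<in> space \<nu>. t < \<bar>P \<theta>\<bar>}"
      using s by simp
    also have "\<dots> = measure (completion \<nu>) {\<theta> \<in> space (completion \<nu>). t < \<bar>\<Omega> \<theta>\<bar>}"
    proof (rule measure_eq_AE)
      show "AE \<theta> in completion \<nu>. (\<theta> \<in> {\<theta> \<in> space \<nu>. t < \<bar>P \<theta>\<bar>}) = (\<theta> \<in> {\<theta> \<in> space (completion \<nu>). t < \<bar>\<Omega> \<theta>\<bar>})"
        using AE_completion[OF ae] by eventually_elim simp
    qed (use s s2 in \<open>auto intro: sets_completionI_sets\<close>)
    finally have e: "measure sph {\<theta>. \<bar>P \<theta>\<bar> > t} = measure sphere_measure {\<theta> \<in> space sphere_measure. t < \<bar>\<Omega> \<theta>\<bar>}"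
      by (simp add: sm)
    have "ennreal (t * measure sphere_measure {\<theta> \<in> space sphere_measure. t < \<bar>\<Omega> \<theta>\<bar>} powr (1 / DIM('a))) \<le> ennreal N"
      unfolding N[symmetric] weak_Lp_norm_def using t by (intro SUP_upper) auto
    then show ?thesis unfolding e using t by (simp add: N_def)
  qed
  have N0: "0 \<le> N" by (simp add: N_def)
  have fin1: "(\<integral>\<^sup>+\<theta>. ennreal \<bar>P \<theta>\<bar> \<partial>sph) < \<infinity>"
    by (rule weak_bound_imp_integrable[OF P n N0 Nweak])
  then have int: "integrable sph P" by (intro integrableI_bounded) auto
  have "(\<integral>\<theta>. \<Omega> \<theta> \<partial>sphere_measure) = (\<integral>\<theta>. P \<theta> \<partial>completion \<nu>)"
    unfolding sm using AE_completion[OF ae] \<open>\<Omega> \<in> borel_measurable (completion \<nu>)\<close>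
    by (intro integral_cong_AE) (auto intro: measurable_completion)
  also have "\<dots> = (\<integral>\<theta>. P \<theta> \<partial>\<nu>)" by (rule integral_completion) simp
  also have "\<dots> = (\<integral>\<theta>. P \<theta> \<partial>sph)" unfolding sph by (rule integral_distr[symmetric, OF id]) simp
  finally have "(\<integral>\<theta>. P \<theta> \<partial>sph) = 0" using mean by simp
  then have "enn2real (\<integral>\<^sup>+\<theta>. ennreal (P \<theta>) \<partial>sph) = enn2real (\<integral>\<^sup>+\<theta>. ennreal (- P \<theta>) \<partial>sph)"
    using real_lebesgue_integral_def[OF int] by simp
  moreover have "(\<integral>\<^sup>+\<theta>. ennreal (P \<theta>) \<partial>sph) < \<infinity>" "(\<integral>\<^sup>+\<theta>. ennreal (- P \<theta>) \<partial>sph) < \<infinity>"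
    by (rule le_less_trans[OF _ fin1], intro nn_integral_mono ennreal_leI, simp)+
  ultimately have pn: "(\<integral>\<^sup>+\<theta>. ennreal (P \<theta>) \<partial>sph) = (\<integral>\<^sup>+\<theta>. ennreal (- P \<theta>) \<partial>sph)"
    by (metis ennreal_enn2real infinity_ennreal_def)
  have "AE y in lebesgue. \<Omega> y = P (sgn y)"
  proof -
    obtain E where E: "E \<in> null_sets \<nu>" "{\<theta> \<in> space \<nu>. \<Omega> \<theta> \<noteq> P \<theta>} \<subseteq> E"
      using ae by (auto simp: eventually_ae_filter)
    have Es: "E \<in> sets \<nu>" "E \<subseteq> sphere 0 1" using E(1) sets.sets_into_space[of E \<nu>] by (auto simp: space_\<nu>)
    then have Eb [measurable]: "E \<in> sets borel"
      unfolding sets_\<nu> by (subst (asm) sets_restrict_space_iff) auto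
    \<comment> \<open>The cone over a null set of the sphere is a null set.\<close>
    have "(\<integral>\<^sup>+y. indicator E (sgn y) * 1 \<partial>(lborel :: 'a measure))
      = (\<integral>\<^sup>+\<theta>. indicator E \<theta> \<partial>sph) * (\<integral>\<^sup>+r. ennreal (r ^ (DIM('a) - 1)) * 1 * indicator {0<..} r \<partial>lborel)"
      by (rule nn_integral_radial_product[of "indicator E" "\<lambda>_. 1"]) measurable
    also have "(\<integral>\<^sup>+\<theta>. indicator E \<theta> \<partial>sph) = emeasure sph E" by (rule nn_integral_indicator) simp
    also have "\<dots> = emeasure \<nu> E"
      unfolding sph using Es by (subst emeasure_distr[OF id]) (auto simp: space_\<nu> Int_absorb2)
    also have "\<dots> = 0" using E(1) by auto
    finally have "(\<integral>\<^sup>+y. indicator E (sgn y) \<partial>(lborel :: 'a measure)) = 0" by simp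
    then have "AE y in (lborel :: 'a measure). indicator E (sgn y) = (0::ennreal)"
      by (subst (asm) nn_integral_0_iff_AE) auto
    then have "AE y in (lborel :: 'a measure). \<Omega> y = P (sgn y)"
      using AE_lborel_singleton[of "0::'a"]
    proof eventually_elim
      fix y :: 'a assume y: "indicator E (sgn y) = (0::ennreal)" "y \<noteq> 0"
      then have "sgn y \<notin> E" by (auto simp: indicator_def split: if_splits)
      moreover have "sgn y \<in> space \<nu>" using y by (simp add: space_\<nu> norm_sgn)
      ultimately have "\<Omega> (sgn y) = P (sgn y)" using E(2) by blast
      moreover have "\<Omega> (sgn y) = \<Omega> y"
        using hom y by (simp add: homogeneous_degree_zero_def sgn_div_norm)
      ultimately show "\<Omega> y = P (sgn y)" by simp
    qed
    then show ?thesis by (rule AE_completion)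
  qed
  with P N0 N Nweak pn show thesis by (intro that) auto
qed

section \<open>The pointwise estimate\<close>

text \<open>
  For fixed \<open>x\<close> the estimate for truncated integrals is applied to \<open>y \<mapsto> f (x - y)\<close>, and the resulting
  Riesz potential of the gradient is compared with the potential operator of the weight.
\<close>
theorem maximal_rough_integral_le_potential_op:
  assumes "2 \<le> DIM('a::euclidean_space)"
  shows "\<exists>c::real. 0 < c \<and>
    (\<forall>(\<Omega> :: 'a \<Rightarrow> real) (w :: 'a \<Rightarrow> real).
       homogeneous_degree_zero \<Omega> \<longrightarrow>
       (\<integral>\<theta>. \<Omega> \<theta> \<partial>sphere_measure) = 0 \<longrightarrow>
       \<Omega> \<in> weak_Lp sphere_measure (real DIM('a)) \<longrightarrow>
       w \<in> A1_weights \<longrightarrow>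
       (\<forall>(f :: 'a \<Rightarrow> real) (x :: 'a).
          smooth f \<longrightarrow> compactly_supported f \<longrightarrow>
          maximal_rough_integral \<Omega> f x \<le>
            ennreal c * weak_Lp_norm sphere_measure (real DIM('a)) \<Omega>
              * ennreal (A1_const w) * potential_op w (\<lambda>y. norm (gradient f y)) x))"
proof -
  let ?n = "DIM('a)" and ?v = "measure lborel (ball (0 :: 'a) 1)"
  note n = assms
  obtain C where C: "0 < C" and riesz: "\<forall>(P :: 'a \<Rightarrow> real) g G N M R t.
    P \<in> borel_measurable borel \<longrightarrow> g \<in> borel_measurable borel \<longrightarrow> G \<in> borel_measurable borel \<longrightarrow>
    0 \<le> N \<longrightarrow> (\<forall>t>0. t * measure sph {\<theta>. \<bar>P \<theta>\<bar> > t} powr (1 / DIM('a)) \<le> N) \<longrightarrow>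
    (\<integral>\<^sup>+\<theta>. ennreal (P \<theta>) \<partial>sph) = (\<integral>\<^sup>+\<theta>. ennreal (- P \<theta>) \<partial>sph) \<longrightarrow>
    (\<forall>y. \<bar>g y\<bar> \<le> M) \<longrightarrow> (\<forall>y. R \<le> norm y \<longrightarrow> g y = 0) \<longrightarrow>
    (\<forall>a b. ennreal \<bar>g a - g b\<bar> \<le> (\<integral>\<^sup>+s. ennreal (norm (b - a)) * G (a + s *\<^sub>R (b - a)) * indicator {0<..<1} s \<partial>lborel)) \<longrightarrow>
    0 < t \<longrightarrow>
    ennreal \<bar>LINT y:{y. norm y > t}|lborel. P (sgn y) / norm y ^ DIM('a) * g y\<bar>
      \<le> ennreal (C * N) * (\<integral>\<^sup>+v. ennreal (1 / norm v ^ (DIM('a) - 1)) * G v \<partial>lborel)"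
    using truncated_rough_integral_le_riesz_potential[OF n] by (elim exE conjE) (rule that)
  have v: "0 < ?v" using content_ball_pos[of 1 "0 :: 'a"] by simp
  show ?thesis
  proof (intro exI[of _ "C * (?v * 2 ^ ?n)"] conjI allI impI)
    show "0 < C * (?v * 2 ^ ?n)" using C v by simp
  next
    fix \<Omega> w f :: "'a \<Rightarrow> real" and x :: "'a"
    assume hom: "homogeneous_degree_zero \<Omega>" and mean: "(\<integral>\<theta>. \<Omega> \<theta> \<partial>sphere_measure) = 0"
      and weak: "\<Omega> \<in> weak_Lp sphere_measure (real ?n)" and w: "w \<in> A1_weights"
      and f: "smooth f" and supp: "compactly_supported f"
    obtain P N where P [measurable]: "P \<in> borel_measurable borel" and N: "0 \<le> N"
      and norm: "weak_Lp_norm sphere_measure (real ?n) \<Omega> = ennreal N"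
      and Nweak: "\<forall>t>0. t * measure sph {\<theta>. \<bar>P \<theta>\<bar> > t} powr (1 / DIM('a)) \<le> N"
      and pn: "(\<integral>\<^sup>+\<theta>. ennreal (P \<theta>) \<partial>sph) = (\<integral>\<^sup>+\<theta>. ennreal (- P \<theta>) \<partial>sph)"
      and ae: "AE y in lebesgue. \<Omega> y = P (sgn y)"
      by (rule sphere_representative[OF hom n mean weak], rule that; assumption)
    have fc: "continuous_on UNIV f"
      using smooth_differentiable[OF f]
      by (auto intro!: continuous_at_imp_continuous_on differentiable_imp_continuous_within)
    then have [measurable]: "f \<in> borel_measurable borel" by (rule borel_measurable_continuous_onI)
    have [measurable]: "gradient f \<in> borel_measurable borel"
      using smooth_continuous_gradient[OF f] by (rule borel_measurable_continuous_onI)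
    let ?K = "closure {x. f x \<noteq> 0}"
    have K: "compact ?K" using supp by (simp add: compactly_supported_def)
    have "bounded ?K" using K by (rule compact_imp_bounded)
    then obtain b where b: "\<forall>y\<in>?K. norm y \<le> b" unfolding bounded_iff by (elim exE) (rule that)
    have "compact (f ` ?K)"
      by (rule compact_continuous_image[OF continuous_on_subset[OF fc subset_UNIV] K])
    then have "bounded (f ` ?K)" by (rule compact_imp_bounded)
    then obtain M where "\<forall>z\<in>f ` ?K. norm z \<le> M" unfolding bounded_iff by (elim exE) (rule that)
    then have M: "\<And>y. y \<in> ?K \<Longrightarrow> \<bar>f y\<bar> \<le> M" by simp
    have in_K: "y \<in> ?K" if "f y \<noteq> 0" for y
      by (rule subsetD[OF closure_subset]) (use that in simp)
    have M': "\<bar>f y\<bar> \<le> max M 0" for y using M[of y] in_K[of y] by (cases "f y = 0") auto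
    define R where "R = b + norm x + 1"
    have R: "f (x - y) = 0" if "R \<le> norm y" for y
    proof (rule ccontr)
      assume "f (x - y) \<noteq> 0"
      then have "norm (x - y) \<le> b" by (rule bspec[OF b in_K])
      then show False using that norm_triangle_ineq4[of x "x - y"] by (simp add: R_def)
    qed
    have path: "ennreal \<bar>f (x - a) - f (x - c)\<bar>
      \<le> (\<integral>\<^sup>+s. ennreal (norm (c - a)) * ennreal (norm (gradient f (x - (a + s *\<^sub>R (c - a))))) * indicator {0<..<1} s \<partial>lborel)" for a c
    proof -
      have e: "x - a + s *\<^sub>R (x - c - (x - a)) = x - (a + s *\<^sub>R (c - a))" for s
        by (simp add: algebra_simps)
      have m: "norm (x - c - (x - a)) = norm (c - a)" by (simp add: norm_minus_commute)
      show ?thesis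
        using difference_le_line_integral_gradient[OF f, of "x - a" "x - c"] unfolding e m .
    qed
    have "(\<integral>\<^sup>+y. ennreal (1 / norm (x - y) ^ (?n - 1)) * ennreal (norm (gradient f y)) \<partial>lborel)
      = ennreal (\<bar>- 1\<bar> ^ DIM('a)) * (\<integral>\<^sup>+v. ennreal (1 / norm (x - (x + (- 1) *\<^sub>R v)) ^ (?n - 1)) * ennreal (norm (gradient f (x + (- 1) *\<^sub>R v))) \<partial>lborel)"
      by (rule nn_integral_lborel_affine) auto
    then have I: "(\<integral>\<^sup>+v. ennreal (1 / norm v ^ (?n - 1)) * ennreal (norm (gradient f (x - v))) \<partial>lborel)
      = (\<integral>\<^sup>+y. ennreal (1 / norm (x - y) ^ (?n - 1)) * ennreal (norm (gradient f y)) \<partial>lborel)"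
      by simp
    have gm: "(\<lambda>y. f (x - y)) \<in> borel_measurable borel"
      and Gm: "(\<lambda>v. ennreal (norm (gradient f (x - v)))) \<in> borel_measurable borel" by measurable
    have bounded_all: "\<forall>y. \<bar>f (x - y)\<bar> \<le> max M 0" and supp_all: "\<forall>y. R \<le> norm y \<longrightarrow> f (x - y) = 0"
      using M' R by blast+
    have path_all: "\<forall>a b. ennreal \<bar>f (x - a) - f (x - b)\<bar>
      \<le> (\<integral>\<^sup>+s. ennreal (norm (b - a)) * ennreal (norm (gradient f (x - (a + s *\<^sub>R (b - a))))) * indicator {0<..<1} s \<partial>lborel)"
      by (intro allI path)
    show "maximal_rough_integral \<Omega> f x \<le> ennreal (C * (?v * 2 ^ ?n)) * weak_Lp_norm sphere_measure (real ?n) \<Omega>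
              * ennreal (A1_const w) * potential_op w (\<lambda>y. norm (gradient f y)) x"
      unfolding maximal_rough_integral_def
    proof (rule SUP_least)
      fix t :: real assume "t \<in> {0<..}"
      then have t: "0 < t" by simp
      let ?F = "\<lambda>y. indicator {y. norm y > t} y *\<^sub>R (P (sgn y) / norm y ^ ?n * f (x - y))"
      let ?F\<Omega> = "\<lambda>y. indicator {y. norm y > t} y *\<^sub>R (\<Omega> y / norm y ^ ?n * f (x - y))"
      have F: "?F \<in> borel_measurable lebesgue" by (rule measurable_completion) measurable
      have ae': "AE y in lebesgue. ?F y = ?F\<Omega> y" using ae by eventually_elim simp
      have "(LINT y:{y. norm y > t}|lebesgue. \<Omega> y / norm y ^ DIM('a) * f (x - y)) = integral\<^sup>L lebesgue ?F"
        unfolding set_lebesgue_integral_def using ae' borel_measurable_AE[OF F ae'] F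
        by (intro integral_cong_AE) auto
      also have "\<dots> = integral\<^sup>L lborel ?F" by (rule integral_completion) measurable
      finally have e: "(LINT y:{y. norm y > t}|lebesgue. \<Omega> y / norm y ^ DIM('a) * f (x - y))
        = (LINT y:{y. norm y > t}|lborel. P (sgn y) / norm y ^ DIM('a) * f (x - y))"
        by (simp add: set_lebesgue_integral_def)
      note riesz_t = riesz[THEN spec[of _ P], THEN spec[of _ "\<lambda>y. f (x - y)"],
        THEN spec[of _ "\<lambda>v. ennreal (norm (gradient f (x - v)))"], THEN spec[of _ N],
        THEN spec[of _ "max M 0"], THEN spec[of _ R], THEN spec[of _ t]]
      have "ennreal \<bar>LINT y:{y. norm y > t}|lborel. P (sgn y) / norm y ^ DIM('a) * f (x - y)\<bar>
        \<le> ennreal (C * N) * (\<integral>\<^sup>+v. ennreal (1 / norm v ^ (DIM('a) - 1)) * ennreal (norm (gradient f (x - v))) \<partial>lborel)"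
        by (rule riesz_t[THEN mp, OF P, THEN mp, OF gm, THEN mp, OF Gm, THEN mp, OF N, THEN mp, OF Nweak,
          THEN mp, OF pn, THEN mp, OF bounded_all, THEN mp, OF supp_all, THEN mp, OF path_all, THEN mp, OF t])
      also have "\<dots> = ennreal (C * N) * (\<integral>\<^sup>+y. ennreal (1 / norm (x - y) ^ (DIM('a) - 1)) * ennreal (norm (gradient f y)) \<partial>lborel)"
        using I by simp
      also have "\<dots> \<le> ennreal (C * N) * (ennreal (?v * 2 ^ DIM('a) * A1_const w) * potential_op w (\<lambda>y. norm (gradient f y)) x)"
        by (intro mult_left_mono riesz_potential_le_potential_op w) auto
      also have "\<dots> = ennreal (C * (?v * 2 ^ ?n)) * ennreal N * ennreal (A1_const w) * potential_op w (\<lambda>y. norm (gradient f y)) x"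
      proof -
        have A: "0 \<le> A1_const w" using A1_const_attained(1)[OF w] by simp
        have e1: "ennreal (C * N) = ennreal C * ennreal N"
          using C N by (intro ennreal_mult) auto
        have e2: "ennreal (?v * 2 ^ ?n * A1_const w) = ennreal (?v * 2 ^ ?n) * ennreal (A1_const w)"
          using A by (intro ennreal_mult) auto
        have e3: "ennreal (C * (?v * 2 ^ ?n)) = ennreal C * ennreal (?v * 2 ^ ?n)"
          using C by (intro ennreal_mult) auto
        show ?thesis unfolding e1 e2 e3 by (simp only: mult_ac)
      qed
      finally show "ennreal \<bar>LINT y:{y. norm y > t}|lebesgue. \<Omega> y / norm y ^ DIM('a) * f (x - y)\<bar>
        \<le> ennreal (C * (?v * 2 ^ ?n)) * weak_Lp_norm sphere_measure (real ?n) \<Omega>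
              * ennreal (A1_const w) * potential_op w (\<lambda>y. norm (gradient f y)) x"
        unfolding e norm .
    qed
  qed
qed

theorem theorem2p3:
  assumes "CARD('n::finite) \<ge> 2"
  shows "\<exists>c::real. 0 < c \<and>
    (\<forall>(\<Omega> :: real ^ 'n \<Rightarrow> real) (w :: real ^ 'n \<Rightarrow> real).
       homogeneous_degree_zero \<Omega> \<longrightarrow>
       (\<integral>\<theta>. \<Omega> \<theta> \<partial>sphere_measure) = 0 \<longrightarrow>
       \<Omega> \<in> weak_Lp sphere_measure (real CARD('n)) \<longrightarrow>
       w \<in> A1_weights \<longrightarrow>
       (\<forall>(f :: real ^ 'n \<Rightarrow> real) (x :: real ^ 'n).
          smooth f \<longrightarrow> compactly_supported f \<longrightarrow>
          maximal_rough_integral \<Omega> f x \<le>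
            ennreal c * weak_Lp_norm sphere_measure (real CARD('n)) \<Omega>
              * ennreal (A1_const w) * potential_op w (\<lambda>y. norm (gradient f y)) x))"
  using maximal_rough_integral_le_potential_op[where 'a = "real ^ 'n"] assms by simp

end
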